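(* Let $H$ be a finite dimensional $C^*$-Hopf algebra with dual $H^0$ and $N=\dim H$, and let $\rho$ be the coaction of $H^0$ on the UHF-algebra $B$ of type $N^\infty$ obtained as the inductive limit of the coactions $\rho_n=\mathrm{Ad}(u_n)\circ(\,\cdot\otimes1^0)$ on $A_n=\bigotimes_1^n(H^0\rtimes_{\Delta^0}H)$, as constructed in the context. Then $\rho$ is approximately representable.
   Context: $\mathrm{Ad}(v)(y)=vyv^*$ for a unitary $v$. Hopf algebras. A finite dimensional $C^*$-Hopf algebra $K$ is a finite dimensional $C^*$-algebra with a Hopf algebra structure whose comultiplication $\Delta_K$ and counit $\epsilon_K$ are $*$-homomorphisms and whose antipode $S_K$ satisfies $S_K(S_K(k)^* )^*=k$. Sweedler notation: $\Delta_K(k)=k_{(1)}\otimes k_{(2)}$. The dual $C^*$-Hopf algebra $K^0$ is the dual space of $K$ with $(\phi\psi)(k)=\phi(k_{(1)})\psi(k_{(2)})$, unit $\epsilon_K$, comultiplication given by $\Delta_{K^0}(\phi)(k\otimes l)=\phi(kl)$, counit $\phi\mapsto\phi(1)$, antipode $\phi\mapsto\phi\circ S_K$, involution $\phi^*(k)=\overline{\phi(S_K(k)^* )}$. We identify $(K^0)^0=K$. The unit and comultiplication of $H^0$ are $1^0$ and $\Delta^0$. A coaction of $K$ on a unital $C^*$-algebra $A$ is a unital $*$-homomorphism $\rho:A\to A\otimes K$ with $(\mathrm{id}\otimes\epsilon_K)\circ\rho=\mathrm{id}$ and $(\rho\otimes\mathrm{id})\circ\rho=(\mathrm{id}\otimes\Delta_K)\circ\rho$.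 With $\phi\cdot a=(\mathrm{id}\otimes\phi)(\rho(a))$ for $\phi\in K^0$, the crossed product $A\rtimes_\rho K^0$ is the unital $C^*$-algebra with underlying space $A\otimes K^0$ (elements $a\rtimes\phi$), product $(a\rtimes\phi)(b\rtimes\psi)=a[\phi_{(1)}\cdot b]\rtimes\phi_{(2)}\psi$ and involution $(a\rtimes\phi)^*=[\phi_{(1)}^*\cdot a^*]\rtimes\phi_{(2)}^*$. Construction. Regard $\Delta^0$ as a coaction of $H^0$ on the $C^*$-algebra $H^0$ and let $A=H^0\rtimes_{\Delta^0}H$, which is isomorphic to $M_N(\mathbb C)$. Let $A_n=\bigotimes_1^nA$ with inclusions $\imath_n:A_n\to A_{n+1}$, $\imath_n(a)=a\otimes(1^0\rtimes1)$, and let $B$ be the inductive limit $C^*$-algebra, a UHF-algebra of type $N^\infty$. Let $V\in A\otimes H^0$ be the unitary determined by $(\mathrm{id}\otimes h)(V)=1^0\rtimes h$ for $h\in H$ (with $h$ regarded as a functional on $H^0$). For $i\le n$ let $v_i\in A_n\otimes H^0$ be the unitary which is $V$ placed in the $i$-th tensor factor of $A_n$ and in $H^0$, and the unit in the other tensor factors. Put $u_n=v_1v_2\cdots v_n\in A_n\otimes H^0$ and $\rho_n(a)=u_n(a\otimes1^0)u_n^*$ for $a\in A_n$. Each $\rho_n$ is a coaction of $H^0$ on $A_n$ and $(\imath_n\otimes\mathrm{id})\circ\rho_n=\rho_{n+1}\circ\imath_n$; $\rho:B\to B\otimes H^0$ is the resulting inductive limit coaction. Approximate representability. For a unital $C^*$-algebra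 $D$, $D^\infty=l^\infty(\mathbb N,D)/c_0(D)$, and $D\subset D^\infty$ via constant sequences. For a coaction $\beta$ of $K$ on $D$, $\beta^\infty((d_n))=(\beta(d_n))$ is a coaction of $K$ on $D^\infty$. $\beta$ is approximately representable if there is a unitary $w\in D^\infty\otimes K$ such that (1) $\beta(d)=w(d\otimes1)w^*$ for all $d\in D$; (2) $(w\otimes1)(\iota\otimes\mathrm{id})(w)=(\mathrm{id}\otimes\Delta_K)(w)$, where $\iota:D^\infty\to D^\infty\otimes K$, $\iota(d)=d\otimes1$; (3) $(\beta^\infty\otimes\mathrm{id})(w)(w\otimes1)=(\mathrm{id}\otimes\Delta_K)(w)$. *)

theory Defs
  imports "HOL-Analysis.Analysis" "HOL-Library.Poly_Mapping"
begin

section \<open>Complex vector spaces and C*-algebras\<close>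

class complex_vector = ab_group_add +
  fixes scaleC :: "complex \<Rightarrow> 'a \<Rightarrow> 'a"  (infixr \<open>*\<^sub>C\<close> 75)
  assumes scaleC_add_right: "a *\<^sub>C (x + y) = a *\<^sub>C x + a *\<^sub>C y"
    and scaleC_add_left: "(a + b) *\<^sub>C x = a *\<^sub>C x + b *\<^sub>C x"
    and scaleC_scaleC [simp]: "a *\<^sub>C b *\<^sub>C x = (a * b) *\<^sub>C x"
    and scaleC_one [simp]: "1 *\<^sub>C x = x"

global_interpretation complex_vector:
  vector_space "scaleC :: complex \<Rightarrow> 'a \<Rightarrow> 'a :: complex_vector"
  by unfold_locales (simp_all add: scaleC_add_right scaleC_add_left)

abbreviation clinear :: "('a::complex_vector \<Rightarrow> 'b::complex_vector) \<Rightarrow> bool"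
  where "clinear \<equiv> Vector_Spaces.linear scaleC scaleC"

lemma clinear_iff:
  "clinear f \<longleftrightarrow> (\<forall>x y. f (x + y) = f x + f y) \<and> (\<forall>c x. f (c *\<^sub>C x) = c *\<^sub>C f x)"
  by (auto simp: Vector_Spaces.linear_def module_hom_def module_hom_axioms_def
      complex_vector.vector_space_axioms complex_vector.module_axioms)

instantiation complex :: complex_vector
begin
definition scaleC_complex :: "complex \<Rightarrow> complex \<Rightarrow> complex" where
  [simp]: "scaleC_complex c x = c * x"
instance by standard (simp_all add: algebra_simps)
end

class star_algebra = complex_vector + ring_1 +
  fixes adj :: "'a \<Rightarrow> 'a"
  assumes mult_scaleC_left: "(c *\<^sub>C x) * y = c *\<^sub>C (x * y)"
    and mult_scaleC_right: "x * (c *\<^sub>C y) = c *\<^sub>C (x * y)"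
    and adj_add: "adj (x + y) = adj x + adj y"
    and adj_scaleC: "adj (c *\<^sub>C x) = cnj c *\<^sub>C adj x"
    and adj_mult: "adj (x * y) = adj y * adj x"
    and adj_adj: "adj (adj x) = x"

text \<open>Nonzero unital C*-algebras.\<close>

class cstar_algebra = star_algebra + banach + real_normed_algebra_1 +
  assumes scaleR_scaleC: "r *\<^sub>R x = complex_of_real r *\<^sub>C x"
    and norm_scaleC: "norm (c *\<^sub>C x) = cmod c * norm x"
    and cstar_identity: "norm (adj x * x) = (norm x)\<^sup>2"

lemma adj_diff: "adj (x - y) = adj x - adj (y :: 'a::star_algebra)"
  by (metis adj_add add_diff_cancel diff_add_cancel)

lemma norm_adj [simp]: "norm (adj x) = norm (x :: 'a::cstar_algebra)"
proof -
  have le: "norm y \<le> norm (adj y)" for y :: 'a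
  proof (cases "y = 0")
    case False
    have "norm y * norm y \<le> norm (adj y) * norm y"
      using norm_mult_ineq[of "adj y" y] by (simp add: cstar_identity power2_eq_square)
    with False show ?thesis by simp
  qed simp
  show ?thesis using le[of x] le[of "adj x"] by (simp add: adj_adj)
qed

text \<open>
  The *-algebras that depend on other data (duals, crossed products, tensor products) cannot be
  instances of a type class; their operations are collected in a record, the vector space
  structure always being that of the type.
\<close>

record ('a::complex_vector) star_alg =
  mult :: "'a \<Rightarrow> 'a \<Rightarrow> 'a"
  unit :: 'a
  star :: "'a \<Rightarrow> 'a"

definition class_alg :: "('a::star_algebra) star_alg" where
  "class_alg = \<lparr>mult = (*), unit = 1, star = adj\<rparr>"

definition is_star_algebra :: "('a::complex_vector, 'z) star_alg_scheme \<Rightarrow> bool" where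
  "is_star_algebra A \<longleftrightarrow>
     (\<forall>x. clinear (mult A x)) \<and> (\<forall>y. clinear (\<lambda>x. mult A x y)) \<and>
     (\<forall>x y z. mult A (mult A x y) z = mult A x (mult A y z)) \<and>
     (\<forall>x. mult A (unit A) x = x \<and> mult A x (unit A) = x) \<and>
     (\<forall>x y. star A (x + y) = star A x + star A y) \<and>
     (\<forall>c x. star A (c *\<^sub>C x) = cnj c *\<^sub>C star A x) \<and>
     (\<forall>x y. star A (mult A x y) = mult A (star A y) (star A x)) \<and>
     (\<forall>x. star A (star A x) = x)"

definition is_cstar_norm :: "('a::complex_vector, 'z) star_alg_scheme \<Rightarrow> ('a \<Rightarrow> real) \<Rightarrow> bool" where
  "is_cstar_norm A nrm \<longleftrightarrow>
     (\<forall>x. nrm x \<ge> 0) \<and> (\<forall>x. nrm x = 0 \<longleftrightarrow> x = 0) \<and>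
     (\<forall>x y. nrm (x + y) \<le> nrm x + nrm y) \<and>
     (\<forall>c x. nrm (c *\<^sub>C x) = cmod c * nrm x) \<and>
     (\<forall>x y. nrm (mult A x y) \<le> nrm x * nrm y) \<and>
     (\<forall>x. nrm (mult A (star A x) x) = (nrm x)\<^sup>2)"

text \<open>In finite dimension every norm is complete and there is at most one C*-norm.\<close>

definition finite_dim_cstar_algebra :: "('a::complex_vector, 'z) star_alg_scheme \<Rightarrow> bool" where
  "finite_dim_cstar_algebra A \<longleftrightarrow> is_star_algebra A \<and>
     (\<exists>S. finite S \<and> complex_vector.span S = (UNIV :: 'a set)) \<and>
     (\<exists>nrm. is_cstar_norm A nrm)"

definition unitary_in :: "('a::complex_vector, 'z) star_alg_scheme \<Rightarrow> 'a \<Rightarrow> bool" where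
  "unitary_in A u \<longleftrightarrow> mult A (star A u) u = unit A \<and> mult A u (star A u) = unit A"

text \<open>
  Unital *-homomorphisms on a subspace S; the map is linear on the whole ambient type, and its
  values outside S are irrelevant.
\<close>

definition unital_star_hom_on ::
  "'a set \<Rightarrow> ('a::complex_vector, 'y) star_alg_scheme \<Rightarrow> ('b::complex_vector, 'z) star_alg_scheme
    \<Rightarrow> ('a \<Rightarrow> 'b) \<Rightarrow> bool" where
  "unital_star_hom_on S A B f \<longleftrightarrow> clinear f \<and> f (unit A) = unit B \<and>
     (\<forall>x\<in>S. \<forall>y\<in>S. f (mult A x y) = mult B (f x) (f y)) \<and>
     (\<forall>x\<in>S. f (star A x) = star B (f x))"

abbreviation "unital_star_hom \<equiv> unital_star_hom_on UNIV"


section \<open>Tensor products\<close>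

text \<open>
  The finitely supported functions form the free complex vector space on a set; the algebraic
  tensor product is its quotient by the bilinearity relations. (All tensor products below have
  a finite dimensional factor or only finite dimensional factors, so no completion is involved.)
\<close>

instantiation poly_mapping :: (type, complex_vector) complex_vector
begin
definition scaleC_poly_mapping :: "complex \<Rightarrow> ('a \<Rightarrow>\<^sub>0 'b) \<Rightarrow> ('a \<Rightarrow>\<^sub>0 'b)" where
  "scaleC_poly_mapping c f = Poly_Mapping.map (scaleC c) f"

lemma lookup_scaleC [simp]:
  "Poly_Mapping.lookup (c *\<^sub>C f) k = c *\<^sub>C Poly_Mapping.lookup f k"
  unfolding scaleC_poly_mapping_def by transfer (simp add: when_def)

instance
  by standard (rule poly_mapping_eqI; simp add: lookup_add scaleC_add_right scaleC_add_left)+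
end

abbreviation gen :: "'x \<Rightarrow> ('x \<Rightarrow>\<^sub>0 complex)" where
  "gen x \<equiv> Poly_Mapping.single x 1"

definition lin_ext :: "('x \<Rightarrow> 'c::complex_vector) \<Rightarrow> ('x \<Rightarrow>\<^sub>0 complex) \<Rightarrow> 'c" where
  "lin_ext f r = (\<Sum>x\<in>Poly_Mapping.keys r. Poly_Mapping.lookup r x *\<^sub>C f x)"

definition conj_ext :: "('x \<Rightarrow> 'c::complex_vector) \<Rightarrow> ('x \<Rightarrow>\<^sub>0 complex) \<Rightarrow> 'c" where
  "conj_ext f r = (\<Sum>x\<in>Poly_Mapping.keys r. cnj (Poly_Mapping.lookup r x) *\<^sub>C f x)"

definition tensor_relations :: "(('a::complex_vector \<times> 'b::complex_vector) \<Rightarrow>\<^sub>0 complex) set" where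
  "tensor_relations = complex_vector.span (
     {gen (a + a', b) - gen (a, b) - gen (a', b) | a a' b. True} \<union>
     {gen (a, b + b') - gen (a, b) - gen (a, b') | a b b'. True} \<union>
     {gen (c *\<^sub>C a, b) - c *\<^sub>C gen (a, b) | c a b. True} \<union>
     {gen (a, c *\<^sub>C b) - c *\<^sub>C gen (a, b) | c a b. True})"

lemma equivp_subspace:
  assumes "complex_vector.subspace S"
  shows "equivp (\<lambda>x y. x - y \<in> S)"
proof (rule equivpI)
  show "reflp (\<lambda>x y. x - y \<in> S)"
    using assms by (simp add: reflp_def complex_vector.subspace_0)
  show "symp (\<lambda>x y. x - y \<in> S)"
    using complex_vector.subspace_neg[OF assms] by (metis minus_diff_eq sympI)
  show "transp (\<lambda>x y. x - y \<in> S)"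
  proof (rule transpI)
    fix x y z assume "x - y \<in> S" "y - z \<in> S"
    from complex_vector.subspace_add[OF assms this] show "x - z \<in> S" by simp
  qed
qed

quotient_type (overloaded) ('a, 'b) tensor =
  "(('a::complex_vector \<times> 'b::complex_vector) \<Rightarrow>\<^sub>0 complex)" / "\<lambda>x y. x - y \<in> tensor_relations"
  morphisms rep_tensor abs_tensor
  by (rule equivp_subspace) (simp add: tensor_relations_def complex_vector.subspace_span)

lemma tensor_relations_closed:
  "0 \<in> tensor_relations"
  "x \<in> tensor_relations \<Longrightarrow> y \<in> tensor_relations \<Longrightarrow> x + y \<in> tensor_relations"
  "x \<in> tensor_relations \<Longrightarrow> y \<in> tensor_relations \<Longrightarrow> x - y \<in> tensor_relations"
  "x \<in> tensor_relations \<Longrightarrow> - x \<in> tensor_relations"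
  "x \<in> tensor_relations \<Longrightarrow> c *\<^sub>C x \<in> tensor_relations"
  unfolding tensor_relations_def
  by (simp_all add: complex_vector.span_zero complex_vector.span_add complex_vector.span_diff
      complex_vector.span_neg complex_vector.span_scale)

instantiation tensor :: (complex_vector, complex_vector) complex_vector
begin
lift_definition zero_tensor :: "('a, 'b) tensor" is 0 .
lift_definition plus_tensor :: "('a, 'b) tensor \<Rightarrow> ('a, 'b) tensor \<Rightarrow> ('a, 'b) tensor" is "(+)"
  by (metis add_diff_add tensor_relations_closed(2))
lift_definition uminus_tensor :: "('a, 'b) tensor \<Rightarrow> ('a, 'b) tensor" is uminus
  by (metis minus_diff_minus tensor_relations_closed(4))
lift_definition minus_tensor :: "('a, 'b) tensor \<Rightarrow> ('a, 'b) tensor \<Rightarrow> ('a, 'b) tensor" is "(-)"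
proof -
  fix x x' y y' :: "('a \<times> 'b) \<Rightarrow>\<^sub>0 complex"
  assume "x - x' \<in> tensor_relations" "y - y' \<in> tensor_relations"
  from tensor_relations_closed(3)[OF this] show "x - y - (x' - y') \<in> tensor_relations"
    by (simp add: algebra_simps)
qed
lift_definition scaleC_tensor :: "complex \<Rightarrow> ('a, 'b) tensor \<Rightarrow> ('a, 'b) tensor" is scaleC
  by (metis complex_vector.scale_right_diff_distrib tensor_relations_closed(5))
instance
  by standard (transfer; simp add: tensor_relations_closed scaleC_add_right scaleC_add_left algebra_simps)+
end

lift_definition tensor :: "'a::complex_vector \<Rightarrow> 'b::complex_vector \<Rightarrow> ('a, 'b) tensor" (infixr \<open>\<otimes>\<^sub>t\<close> 73)
  is "\<lambda>a b. gen (a, b)" .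

text \<open>
  \<open>tlift f\<close> is the linear map with value \<open>f a b\<close> on elementary tensors, for bilinear \<open>f\<close>; it
  also renders Sweedler notation: \<open>tlift f (\<Delta> k)\<close> is $f(k_{(1)}, k_{(2)})$. \<open>tlift_conj f\<close> is the
  conjugate linear map with value \<open>f a b\<close> on elementary tensors, for \<open>f\<close> conjugate linear in
  both arguments.
\<close>

definition tlift :: "('a::complex_vector \<Rightarrow> 'b::complex_vector \<Rightarrow> 'c::complex_vector)
    \<Rightarrow> ('a, 'b) tensor \<Rightarrow> 'c" where
  "tlift f t = lin_ext (\<lambda>(a, b). f a b) (rep_tensor t)"

definition tlift_conj :: "('a::complex_vector \<Rightarrow> 'b::complex_vector \<Rightarrow> 'c::complex_vector)
    \<Rightarrow> ('a, 'b) tensor \<Rightarrow> 'c" where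
  "tlift_conj f t = conj_ext (\<lambda>(a, b). f a b) (rep_tensor t)"

definition tmap :: "('a::complex_vector \<Rightarrow> 'c::complex_vector) \<Rightarrow> ('b::complex_vector \<Rightarrow> 'd::complex_vector)
    \<Rightarrow> ('a, 'b) tensor \<Rightarrow> ('c, 'd) tensor" where
  "tmap f g = tlift (\<lambda>a b. f a \<otimes>\<^sub>t g b)"

definition assoc :: "(('a::complex_vector, 'b::complex_vector) tensor, 'c::complex_vector) tensor
    \<Rightarrow> ('a, ('b, 'c) tensor) tensor" where
  "assoc = tlift (\<lambda>t c. tlift (\<lambda>a b. a \<otimes>\<^sub>t (b \<otimes>\<^sub>t c)) t)"

text \<open>The slice map $\mathrm{id} \otimes \phi$.\<close>

definition slice :: "('k::complex_vector \<Rightarrow> complex) \<Rightarrow> ('d::complex_vector, 'k) tensor \<Rightarrow> 'd" where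
  "slice \<phi> = tlift (\<lambda>d k. \<phi> k *\<^sub>C d)"

definition tensor_alg :: "('a::complex_vector, 'y) star_alg_scheme \<Rightarrow> ('b::complex_vector, 'z) star_alg_scheme
    \<Rightarrow> ('a, 'b) tensor star_alg" where
  "tensor_alg A B = \<lparr>
     mult = (\<lambda>s t. tlift (\<lambda>a b. tlift (\<lambda>a' b'. mult A a a' \<otimes>\<^sub>t mult B b b') t) s),
     unit = unit A \<otimes>\<^sub>t unit B,
     star = tlift_conj (\<lambda>a b. star A a \<otimes>\<^sub>t star B b)\<rparr>"

subsection \<open>Correctness of the lifting operators\<close>

lemma lin_ext_supset:
  assumes "finite S" "Poly_Mapping.keys r \<subseteq> S"
  shows "lin_ext f r = (\<Sum>x\<in>S. Poly_Mapping.lookup r x *\<^sub>C f x)"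
  unfolding lin_ext_def using assms
  by (intro sum.mono_neutral_left) (auto simp: in_keys_iff)

lemma conj_ext_supset:
  assumes "finite S" "Poly_Mapping.keys r \<subseteq> S"
  shows "conj_ext f r = (\<Sum>x\<in>S. cnj (Poly_Mapping.lookup r x) *\<^sub>C f x)"
  unfolding conj_ext_def using assms
  by (intro sum.mono_neutral_left) (auto simp: in_keys_iff)

lemma lin_ext_add: "lin_ext f (r + s) = lin_ext f r + lin_ext f s"
proof -
  let ?S = "Poly_Mapping.keys r \<union> Poly_Mapping.keys s"
  have k: "Poly_Mapping.keys (r + s) \<subseteq> ?S" by (rule Poly_Mapping.keys_add)
  show ?thesis
    using lin_ext_supset[OF _ k, of f] lin_ext_supset[of ?S r f] lin_ext_supset[of ?S s f]
    by (simp add: lookup_add scaleC_add_left sum.distrib)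
qed

lemma lin_ext_scaleC: "lin_ext f (c *\<^sub>C r) = c *\<^sub>C lin_ext f r"
proof -
  have k: "Poly_Mapping.keys (c *\<^sub>C r) \<subseteq> Poly_Mapping.keys r" by (auto simp: in_keys_iff)
  show ?thesis
    using lin_ext_supset[OF _ k, of f]
    by (simp add: lin_ext_def[of f r] complex_vector.scale_sum_right)
qed

lemma conj_ext_add: "conj_ext f (r + s) = conj_ext f r + conj_ext f s"
proof -
  let ?S = "Poly_Mapping.keys r \<union> Poly_Mapping.keys s"
  have k: "Poly_Mapping.keys (r + s) \<subseteq> ?S" by (rule Poly_Mapping.keys_add)
  show ?thesis
    using conj_ext_supset[OF _ k, of f] conj_ext_supset[of ?S r f] conj_ext_supset[of ?S s f]
    by (simp add: lookup_add scaleC_add_left sum.distrib)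
qed

lemma conj_ext_scaleC: "conj_ext f (c *\<^sub>C r) = cnj c *\<^sub>C conj_ext f r"
proof -
  have k: "Poly_Mapping.keys (c *\<^sub>C r) \<subseteq> Poly_Mapping.keys r" by (auto simp: in_keys_iff)
  show ?thesis
    using conj_ext_supset[OF _ k, of f]
    by (simp add: conj_ext_def[of f r] complex_vector.scale_sum_right)
qed

lemma lin_ext_gen [simp]: "lin_ext f (gen x) = f x"
  by (simp add: lin_ext_def)

lemma conj_ext_gen [simp]: "conj_ext f (gen x) = f x"
  by (simp add: conj_ext_def)

lemma lin_ext_diff: "lin_ext f (r - s) = lin_ext f r - lin_ext f s"
  by (metis add_diff_cancel diff_add_cancel lin_ext_add)

lemma conj_ext_diff: "conj_ext f (r - s) = conj_ext f r - conj_ext f s"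
  by (metis add_diff_cancel diff_add_cancel conj_ext_add)

lemma lin_ext_span:
  assumes "x \<in> complex_vector.span R" "\<And>r. r \<in> R \<Longrightarrow> lin_ext f r = 0"
  shows "lin_ext f x = 0"
  using assms(1)
  by (induction rule: complex_vector.span_induct_alt)
    (simp_all add: assms(2) lin_ext_add lin_ext_scaleC lin_ext_def[of f 0])

lemma conj_ext_span:
  assumes "x \<in> complex_vector.span R" "\<And>r. r \<in> R \<Longrightarrow> conj_ext f r = 0"
  shows "conj_ext f x = 0"
  using assms(1)
  by (induction rule: complex_vector.span_induct_alt)
    (simp_all add: assms(2) conj_ext_add conj_ext_scaleC conj_ext_def[of f 0])

lemma rep_abs_tensor: "rep_tensor (abs_tensor r) - r \<in> tensor_relations"
  by (rule rep_abs_rsp_left[OF Quotient3_tensor]) (simp add: tensor_relations_closed)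

lemma tlift_abs:
  assumes "\<And>a. clinear (f a)" "\<And>b. clinear (\<lambda>a. f a b)"
  shows "tlift f (abs_tensor r) = lin_ext (\<lambda>(a, b). f a b) r"
proof -
  have "lin_ext (\<lambda>(a, b). f a b) (rep_tensor (abs_tensor r) - r) = 0"
    using rep_abs_tensor[of r] unfolding tensor_relations_def
    by (rule lin_ext_span) (use assms in \<open>auto simp: lin_ext_diff lin_ext_scaleC clinear_iff\<close>)
  then show ?thesis by (simp add: tlift_def lin_ext_diff)
qed

lemma tlift_conj_abs:
  assumes "\<And>a b b'. f a (b + b') = f a b + f a b'" "\<And>a a' b. f (a + a') b = f a b + f a' b"
    "\<And>c a b. f (c *\<^sub>C a) b = cnj c *\<^sub>C f a b" "\<And>c a b. f a (c *\<^sub>C b) = cnj c *\<^sub>C f a b"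
  shows "tlift_conj f (abs_tensor r) = conj_ext (\<lambda>(a, b). f a b) r"
proof -
  have "conj_ext (\<lambda>(a, b). f a b) (rep_tensor (abs_tensor r) - r) = 0"
    using rep_abs_tensor[of r] unfolding tensor_relations_def
    by (rule conj_ext_span) (use assms in \<open>auto simp: conj_ext_diff conj_ext_scaleC\<close>)
  then show ?thesis by (simp add: tlift_conj_def conj_ext_diff)
qed

lemma tlift_tensor:
  assumes "\<And>a. clinear (f a)" "\<And>b. clinear (\<lambda>a. f a b)"
  shows "tlift f (a \<otimes>\<^sub>t b) = f a b"
  by (simp add: tensor.abs_eq tlift_abs[OF assms])

lemma tlift_linear:
  assumes "\<And>a. clinear (f a)" "\<And>b. clinear (\<lambda>a. f a b)"
  shows "clinear (tlift f)"
  unfolding clinear_iff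
proof safe
  fix s t :: "('a, 'b) tensor" and c
  obtain r r' where [simp]: "s = abs_tensor r" "t = abs_tensor r'"
    by (metis Quotient3_abs_rep[OF Quotient3_tensor])
  show "tlift f (s + t) = tlift f s + tlift f t"
    by (simp add: plus_tensor.abs_eq tlift_abs[OF assms] lin_ext_add)
  show "tlift f (c *\<^sub>C s) = c *\<^sub>C tlift f s"
    by (simp add: scaleC_tensor.abs_eq tlift_abs[OF assms] lin_ext_scaleC)
qed

lemma tlift_conj_tensor:
  assumes "\<And>a b b'. f a (b + b') = f a b + f a b'" "\<And>a a' b. f (a + a') b = f a b + f a' b"
    "\<And>c a b. f (c *\<^sub>C a) b = cnj c *\<^sub>C f a b" "\<And>c a b. f a (c *\<^sub>C b) = cnj c *\<^sub>C f a b"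
  shows "tlift_conj f (a \<otimes>\<^sub>t b) = f a b"
  by (simp add: tensor.abs_eq tlift_conj_abs[OF assms])

lemma tlift_conj_add_scaleC:
  assumes "\<And>a b b'. f a (b + b') = f a b + f a b'" "\<And>a a' b. f (a + a') b = f a b + f a' b"
    "\<And>c a b. f (c *\<^sub>C a) b = cnj c *\<^sub>C f a b" "\<And>c a b. f a (c *\<^sub>C b) = cnj c *\<^sub>C f a b"
  shows "tlift_conj f (s + t) = tlift_conj f s + tlift_conj f t"
    and "tlift_conj f (c *\<^sub>C s) = cnj c *\<^sub>C tlift_conj f s"
proof -
  obtain r r' where [simp]: "s = abs_tensor r" "t = abs_tensor r'"
    by (metis Quotient3_abs_rep[OF Quotient3_tensor])
  show "tlift_conj f (s + t) = tlift_conj f s + tlift_conj f t"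
    by (simp add: plus_tensor.abs_eq tlift_conj_abs[OF assms] conj_ext_add)
  show "tlift_conj f (c *\<^sub>C s) = cnj c *\<^sub>C tlift_conj f s"
    by (simp add: scaleC_tensor.abs_eq tlift_conj_abs[OF assms] conj_ext_scaleC)
qed


section \<open>Finite dimensional C*-Hopf algebras and their duals\<close>

record (overloaded) ('k::complex_vector) hopf = "'k star_alg" +
  comult :: "'k \<Rightarrow> ('k, 'k) tensor"
  counit :: "'k \<Rightarrow> complex"
  antipode :: "'k \<Rightarrow> 'k"

definition complex_alg :: "complex star_alg" where
  "complex_alg = \<lparr>mult = (*), unit = 1, star = cnj\<rparr>"

definition cstar_hopf_algebra :: "('k::complex_vector) hopf \<Rightarrow> bool" where
  "cstar_hopf_algebra K \<longleftrightarrow>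
     finite_dim_cstar_algebra K \<and>
     unital_star_hom K (tensor_alg K K) (comult K) \<and>
     unital_star_hom K complex_alg (counit K) \<and>
     clinear (antipode K) \<and>
     (\<forall>k. assoc (tmap (comult K) id (comult K k)) = tmap id (comult K) (comult K k)) \<and>
     (\<forall>k. tlift (\<lambda>x y. counit K x *\<^sub>C y) (comult K k) = k) \<and>
     (\<forall>k. tlift (\<lambda>x y. counit K y *\<^sub>C x) (comult K k) = k) \<and>
     (\<forall>k. tlift (\<lambda>x y. mult K (antipode K x) y) (comult K k) = counit K k *\<^sub>C unit K) \<and>
     (\<forall>k. tlift (\<lambda>x y. mult K x (antipode K y)) (comult K k) = counit K k *\<^sub>C unit K) \<and>
     (\<forall>k. star K (antipode K (star K (antipode K k))) = k)"

typedef (overloaded) ('k::complex_vector) dual = "{f :: 'k \<Rightarrow> complex. clinear f}"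
  morphisms app Dual
  by (rule exI[of _ "\<lambda>_. 0"]) (simp add: clinear_iff)

setup_lifting type_definition_dual

instantiation dual :: (complex_vector) complex_vector
begin
lift_definition zero_dual :: "'a dual" is "\<lambda>_. 0" by (simp add: clinear_iff)
lift_definition plus_dual :: "'a dual \<Rightarrow> 'a dual \<Rightarrow> 'a dual" is "\<lambda>f g x. f x + g x"
  by (simp add: clinear_iff algebra_simps)
lift_definition uminus_dual :: "'a dual \<Rightarrow> 'a dual" is "\<lambda>f x. - f x"
  by (simp add: clinear_iff algebra_simps)
lift_definition minus_dual :: "'a dual \<Rightarrow> 'a dual \<Rightarrow> 'a dual" is "\<lambda>f g x. f x - g x"
  by (simp add: clinear_iff algebra_simps)
lift_definition scaleC_dual :: "complex \<Rightarrow> 'a dual \<Rightarrow> 'a dual" is "\<lambda>c f x. c * f x"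
  by (simp add: clinear_iff algebra_simps)
instance by standard (transfer; simp add: fun_eq_iff algebra_simps)+
end

text \<open>
  For a finite dimensional C*-Hopf algebra the arguments of \<open>Dual\<close> below are linear, and the
  comultiplication is well defined because the elementary tensors separate the points of the
  tensor product of the dual with itself.
\<close>

definition dual_hopf :: "('k::complex_vector) hopf \<Rightarrow> 'k dual hopf" where
  "dual_hopf K = \<lparr>
     mult = (\<lambda>\<phi> \<psi>. Dual (\<lambda>k. tlift (\<lambda>x y. app \<phi> x * app \<psi> y) (comult K k))),
     unit = Dual (counit K),
     star = (\<lambda>\<phi>. Dual (\<lambda>k. cnj (app \<phi> (star K (antipode K k))))),
     comult = (\<lambda>\<phi>. THE t. \<forall>k l. tlift (\<lambda>\<psi> \<eta>. app \<psi> k * app \<eta> l) t = app \<phi> (mult K k l)),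
     counit = (\<lambda>\<phi>. app \<phi> (unit K)),
     antipode = (\<lambda>\<phi>. Dual (\<lambda>k. app \<phi> (antipode K k)))\<rparr>"


section \<open>Coactions and crossed products\<close>

definition coaction :: "('d::complex_vector, 'z) star_alg_scheme \<Rightarrow> ('k::complex_vector) hopf
    \<Rightarrow> ('d \<Rightarrow> ('d, 'k) tensor) \<Rightarrow> bool" where
  "coaction D K \<rho> \<longleftrightarrow>
     unital_star_hom D (tensor_alg D K) \<rho> \<and>
     (\<forall>d. slice (counit K) (\<rho> d) = d) \<and>
     (\<forall>d. assoc (tmap \<rho> id (\<rho> d)) = tmap id (comult K) (\<rho> d))"

text \<open>
  The crossed product of \<open>D\<close> by the dual \<open>L\<close> of \<open>K\<close>, where \<open>\<rho>\<close> is a coaction of \<open>K\<close> on \<open>D\<close> and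
  \<open>ev l\<close> is the functional on \<open>K\<close> given by \<open>l\<close>. For \<open>L = dual_hopf K\<close> one takes \<open>ev = app\<close>; under
  the identification of \<open>H\<close> with its bidual, \<open>K = dual_hopf H\<close> has dual \<open>L = H\<close>, with
  \<open>ev h \<phi> = app \<phi> h\<close>. The element $a \rtimes l$ is \<open>a \<otimes>\<^sub>t l\<close>.
\<close>

definition crossed_product :: "('d::complex_vector, 'z) star_alg_scheme \<Rightarrow> ('d \<Rightarrow> ('d, 'k::complex_vector) tensor)
    \<Rightarrow> ('l::complex_vector) hopf \<Rightarrow> ('l \<Rightarrow> 'k \<Rightarrow> complex) \<Rightarrow> ('d, 'l) tensor star_alg" where
  "crossed_product D \<rho> L ev = (let act = (\<lambda>l d. slice (ev l) (\<rho> d)) in \<lparr>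
     mult = (\<lambda>s t. tlift (\<lambda>a l. tlift (\<lambda>b m.
               tlift (\<lambda>l1 l2. mult D a (act l1 b) \<otimes>\<^sub>t mult L l2 m) (comult L l)) t) s),
     unit = unit D \<otimes>\<^sub>t unit L,
     star = tlift_conj (\<lambda>a l.
               tlift_conj (\<lambda>l1 l2. act (star L l1) (star D a) \<otimes>\<^sub>t star L l2) (comult L l))\<rparr>)"


section \<open>Tensor powers\<close>

text \<open>
  \<open>'a tpow\<close> is the direct sum over \<open>n\<close> of the \<open>n\<close>-fold tensor powers of \<open>'a\<close>; the \<open>n\<close>-th tensor
  power is the subspace \<open>tpow n\<close>. This gives all of them a common type.
\<close>

definition tpow_relations :: "(('a::complex_vector) list \<Rightarrow>\<^sub>0 complex) set" where
  "tpow_relations = complex_vector.span (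
     {gen (xs @ (a + b) # ys) - gen (xs @ a # ys) - gen (xs @ b # ys) | xs a b ys. True} \<union>
     {gen (xs @ (c *\<^sub>C a) # ys) - c *\<^sub>C gen (xs @ a # ys) | xs c a ys. True})"

quotient_type (overloaded) 'a tpow =
  "('a::complex_vector) list \<Rightarrow>\<^sub>0 complex" / "\<lambda>x y. x - y \<in> tpow_relations"
  morphisms rep_tpow abs_tpow
  by (rule equivp_subspace) (simp add: tpow_relations_def complex_vector.subspace_span)

lemma tpow_relations_closed:
  "0 \<in> tpow_relations"
  "x \<in> tpow_relations \<Longrightarrow> y \<in> tpow_relations \<Longrightarrow> x + y \<in> tpow_relations"
  "x \<in> tpow_relations \<Longrightarrow> y \<in> tpow_relations \<Longrightarrow> x - y \<in> tpow_relations"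
  "x \<in> tpow_relations \<Longrightarrow> - x \<in> tpow_relations"
  "x \<in> tpow_relations \<Longrightarrow> c *\<^sub>C x \<in> tpow_relations"
  unfolding tpow_relations_def
  by (simp_all add: complex_vector.span_zero complex_vector.span_add complex_vector.span_diff
      complex_vector.span_neg complex_vector.span_scale)

instantiation tpow :: (complex_vector) complex_vector
begin
lift_definition zero_tpow :: "'a tpow" is 0 .
lift_definition plus_tpow :: "'a tpow \<Rightarrow> 'a tpow \<Rightarrow> 'a tpow" is "(+)"
  by (metis add_diff_add tpow_relations_closed(2))
lift_definition uminus_tpow :: "'a tpow \<Rightarrow> 'a tpow" is uminus
  by (metis minus_diff_minus tpow_relations_closed(4))
lift_definition minus_tpow :: "'a tpow \<Rightarrow> 'a tpow \<Rightarrow> 'a tpow" is "(-)"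
proof -
  fix x x' y y' :: "'a list \<Rightarrow>\<^sub>0 complex"
  assume "x - x' \<in> tpow_relations" "y - y' \<in> tpow_relations"
  from tpow_relations_closed(3)[OF this] show "x - y - (x' - y') \<in> tpow_relations"
    by (simp add: algebra_simps)
qed
lift_definition scaleC_tpow :: "complex \<Rightarrow> 'a tpow \<Rightarrow> 'a tpow" is scaleC
  by (metis complex_vector.scale_right_diff_distrib tpow_relations_closed(5))
instance
  by standard (transfer; simp add: tpow_relations_closed scaleC_add_right scaleC_add_left algebra_simps)+
end

text \<open>The elementary tensor $x_1 \otimes \dots \otimes x_n$.\<close>

lift_definition elem :: "('a::complex_vector) list \<Rightarrow> 'a tpow" is "\<lambda>xs. gen xs" .

definition tpow :: "nat \<Rightarrow> ('a::complex_vector) tpow set" where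
  "tpow n = complex_vector.span (elem ` {xs. length xs = n})"

text \<open>The (conjugate) linear map with values \<open>f xs\<close> on elementary tensors, for \<open>f\<close> (conjugate)
  multilinear on the lists of each length.\<close>

definition plift :: "('a::complex_vector list \<Rightarrow> 'c::complex_vector) \<Rightarrow> 'a tpow \<Rightarrow> 'c" where
  "plift f t = lin_ext f (rep_tpow t)"

definition plift_conj :: "('a::complex_vector list \<Rightarrow> 'c::complex_vector) \<Rightarrow> 'a tpow \<Rightarrow> 'c" where
  "plift_conj f t = conj_ext f (rep_tpow t)"

lemma rep_abs_tpow: "rep_tpow (abs_tpow r) - r \<in> tpow_relations"
  by (rule rep_abs_rsp_left[OF Quotient3_tpow]) (simp add: tpow_relations_closed)

lemma plift_elem:
  assumes "\<And>xs ys. clinear (\<lambda>a. f (xs @ a # ys))"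
  shows "plift f (elem zs) = f zs"
proof -
  have "lin_ext f (rep_tpow (abs_tpow (gen zs)) - gen zs) = 0"
    using rep_abs_tpow[of "gen zs"] unfolding tpow_relations_def
    by (rule lin_ext_span) (use assms in \<open>auto simp: lin_ext_diff lin_ext_scaleC clinear_iff\<close>)
  then show ?thesis by (simp add: plift_def elem.abs_eq lin_ext_diff)
qed

lemma plift_conj_elem:
  assumes "\<And>xs ys a b. f (xs @ (a + b) # ys) = f (xs @ a # ys) + f (xs @ b # ys)"
    "\<And>xs ys c a. f (xs @ (c *\<^sub>C a) # ys) = cnj c *\<^sub>C f (xs @ a # ys)"
  shows "plift_conj f (elem zs) = f zs"
proof -
  have "conj_ext f (rep_tpow (abs_tpow (gen zs)) - gen zs) = 0"
    using rep_abs_tpow[of "gen zs"] unfolding tpow_relations_def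
    by (rule conj_ext_span) (use assms in \<open>auto simp: conj_ext_diff conj_ext_scaleC\<close>)
  then show ?thesis by (simp add: plift_conj_def elem.abs_eq conj_ext_diff)
qed

text \<open>
  The *-algebra structure of the \<open>n\<close>-th tensor power of \<open>A\<close>, to be used on \<open>tpow n\<close> only. The
  product of tensors of different degrees is set to zero, which makes it bilinear.
\<close>

definition tpow_alg :: "('a::complex_vector) star_alg \<Rightarrow> nat \<Rightarrow> 'a tpow star_alg" where
  "tpow_alg A n = \<lparr>
     mult = (\<lambda>s t. plift (\<lambda>xs. plift (\<lambda>ys.
               if length xs = length ys then elem (map2 (mult A) xs ys) else 0) t) s),
     unit = elem (replicate n (unit A)),
     star = plift_conj (\<lambda>xs. elem (map (star A) xs))\<rparr>"

definition tpow_incl :: "('a::complex_vector) star_alg \<Rightarrow> 'a tpow \<Rightarrow> 'a tpow" where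
  "tpow_incl A = plift (\<lambda>xs. elem (xs @ [unit A]))"

text \<open>\<open>a\<close> in position \<open>i < n\<close> (counted from \<open>0\<close>) and the unit in the other tensor factors.\<close>

definition place :: "('a::complex_vector) star_alg \<Rightarrow> nat \<Rightarrow> nat \<Rightarrow> 'a \<Rightarrow> 'a tpow" where
  "place A n i a = elem ((replicate n (unit A))[i := a])"


section \<open>The coactions on the tensor powers and on their inductive limit\<close>

definition algA :: "('h::complex_vector) hopf \<Rightarrow> ('h dual, 'h) tensor star_alg" where
  "algA H = crossed_product (dual_hopf H) (comult (dual_hopf H)) H (\<lambda>h \<phi>. app \<phi> h)"

definition unitaryV :: "('h::complex_vector) hopf \<Rightarrow> (('h dual, 'h) tensor, 'h dual) tensor" where
  "unitaryV H = (THE V. \<forall>h. slice (\<lambda>\<phi>. app \<phi> h) V = unit (dual_hopf H) \<otimes>\<^sub>t h)"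

abbreviation algAn :: "('h::complex_vector) hopf \<Rightarrow> nat \<Rightarrow> ('h dual, 'h) tensor tpow star_alg" where
  "algAn H n \<equiv> tpow_alg (algA H) n"

abbreviation algAnH0 :: "('h::complex_vector) hopf \<Rightarrow> nat \<Rightarrow> (('h dual, 'h) tensor tpow, 'h dual) tensor star_alg" where
  "algAnH0 H n \<equiv> tensor_alg (algAn H n) (dual_hopf H)"

definition v_at :: "('h::complex_vector) hopf \<Rightarrow> nat \<Rightarrow> nat \<Rightarrow> (('h dual, 'h) tensor tpow, 'h dual) tensor" where
  "v_at H n i = tmap (place (algA H) n i) id (unitaryV H)"

definition u_n :: "('h::complex_vector) hopf \<Rightarrow> nat \<Rightarrow> (('h dual, 'h) tensor tpow, 'h dual) tensor" where
  "u_n H n = foldr (\<lambda>i x. mult (algAnH0 H n) (v_at H n i) x) [0..<n] (unit (algAnH0 H n))"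

definition rho_n :: "('h::complex_vector) hopf \<Rightarrow> nat \<Rightarrow> ('h dual, 'h) tensor tpow
    \<Rightarrow> (('h dual, 'h) tensor tpow, 'h dual) tensor" where
  "rho_n H n a = (let T = algAnH0 H n in
     mult T (mult T (u_n H n) (a \<otimes>\<^sub>t unit (dual_hopf H))) (star T (u_n H n)))"

text \<open>
  A unital C*-algebra \<open>'b\<close> with maps \<open>\<kappa> n : C n \<rightarrow> 'b\<close> is the C*-inductive limit of an increasing
  sequence of finite dimensional C*-algebras \<open>C 1, C 2, \<dots>\<close> with injective connecting maps iff the
  \<open>\<kappa> n\<close> are compatible injective (hence isometric) unital *-homomorphisms whose ranges have dense
  union; this determines it up to unique isomorphism.
\<close>

definition inductive_limit :: "(nat \<Rightarrow> 'a set) \<Rightarrow> (nat \<Rightarrow> ('a::complex_vector) star_alg) \<Rightarrow> (nat \<Rightarrow> 'a \<Rightarrow> 'a)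
    \<Rightarrow> (nat \<Rightarrow> 'a \<Rightarrow> 'b::cstar_algebra) \<Rightarrow> bool" where
  "inductive_limit C alg incl \<kappa> \<longleftrightarrow>
     (\<forall>n\<ge>1. unital_star_hom_on (C n) (alg n) class_alg (\<kappa> n) \<and> inj_on (\<kappa> n) (C n)) \<and>
     (\<forall>n\<ge>1. \<forall>a\<in>C n. \<kappa> (Suc n) (incl n a) = \<kappa> n a) \<and>
     closure (\<Union>n\<in>{1..}. \<kappa> n ` C n) = UNIV"

definition uhf_limit :: "('h::complex_vector) hopf
    \<Rightarrow> (nat \<Rightarrow> ('h dual, 'h) tensor tpow \<Rightarrow> 'b::cstar_algebra) \<Rightarrow> bool" where
  "uhf_limit H \<kappa> \<longleftrightarrow> inductive_limit tpow (algAn H) (\<lambda>_. tpow_incl (algA H)) \<kappa>"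

text \<open>
  The coaction of the dual of \<open>H\<close> on the limit that extends the \<open>rho_n\<close> by continuity. The
  continuity condition holds for every coaction on a C*-algebra (*-homomorphisms of C*-algebras
  are contractive); it is stated because the tensor product carries no norm here, a map into
  it being continuous iff its slices are.
\<close>

definition limit_coaction :: "('h::complex_vector) hopf
    \<Rightarrow> (nat \<Rightarrow> ('h dual, 'h) tensor tpow \<Rightarrow> 'b::cstar_algebra) \<Rightarrow> ('b \<Rightarrow> ('b, 'h dual) tensor) \<Rightarrow> bool" where
  "limit_coaction H \<kappa> \<rho> \<longleftrightarrow>
     coaction class_alg (dual_hopf H) \<rho> \<and>
     (\<forall>h. continuous_on UNIV (\<lambda>b. slice (\<lambda>\<phi>. app \<phi> h) (\<rho> b))) \<and>
     (\<forall>n\<ge>1. \<forall>a\<in>tpow n. \<rho> (\<kappa> n a) = tmap (\<kappa> n) id (rho_n H n a))"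


section \<open>Approximate representability\<close>

text \<open>\<open>'d linf\<close> is $l^\infty(\mathbb{N}, D)/c_0(D)$, as a *-algebra.\<close>

quotient_type (overloaded) 'd linf = "nat \<Rightarrow> 'd::cstar_algebra" /
  partial: "\<lambda>x y. Bseq x \<and> Bseq y \<and> (\<lambda>n. x n - y n) \<longlonglongrightarrow> 0"
  morphisms rep_linf seq_class
proof (rule part_equivpI)
  show "\<exists>x::nat \<Rightarrow> 'd. Bseq x \<and> Bseq x \<and> (\<lambda>n. x n - x n) \<longlonglongrightarrow> 0"
    by (intro exI[of _ "\<lambda>_. 0"]) simp
  show "symp (\<lambda>x y::nat \<Rightarrow> 'd. Bseq x \<and> Bseq y \<and> (\<lambda>n. x n - y n) \<longlonglongrightarrow> 0)"
  proof (rule sympI, safe)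
    fix x y :: "nat \<Rightarrow> 'd"
    assume "(\<lambda>n. x n - y n) \<longlonglongrightarrow> 0"
    from tendsto_minus[OF this] show "(\<lambda>n. y n - x n) \<longlonglongrightarrow> 0" by simp
  qed
  show "transp (\<lambda>x y::nat \<Rightarrow> 'd. Bseq x \<and> Bseq y \<and> (\<lambda>n. x n - y n) \<longlonglongrightarrow> 0)"
  proof (rule transpI, safe)
    fix x y z :: "nat \<Rightarrow> 'd"
    assume "(\<lambda>n. x n - y n) \<longlonglongrightarrow> 0" "(\<lambda>n. y n - z n) \<longlonglongrightarrow> 0"
    from tendsto_add[OF this] show "(\<lambda>n. x n - z n) \<longlonglongrightarrow> 0" by simp
  qed
qed

lemma Bseq_add_same:
  assumes "Bseq x" "Bseq y"
  shows "Bseq (\<lambda>n. x n + y n :: 'd::cstar_algebra)"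
proof -
  obtain K L where K: "\<And>n. norm (x n) \<le> K" and L: "\<And>n. norm (y n) \<le> L"
    using assms by (auto simp: Bseq_def)
  have "norm (x n + y n) \<le> K + L" for n
    using norm_triangle_mono[OF K L] by simp
  then show ?thesis by (rule BseqI')
qed

lemma Bseq_diff_same: "Bseq x \<Longrightarrow> Bseq y \<Longrightarrow> Bseq (\<lambda>n. x n - y n :: 'd::cstar_algebra)"
  using Bseq_add_same[of x "\<lambda>n. - y n"] by (simp add: Bseq_minus_iff)

lemma Bseq_mult_same:
  assumes "Bseq x" "Bseq y"
  shows "Bseq (\<lambda>n. x n * y n :: 'd::cstar_algebra)"
proof -
  obtain K L where K: "\<And>n. norm (x n) \<le> K" and L: "\<And>n. norm (y n) \<le> L"
    using assms by (auto simp: Bseq_def)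
  have "norm (x n * y n) \<le> K * L" for n
    using norm_mult_ineq[of "x n" "y n"] mult_mono'[OF K[of n] L[of n]] by simp
  then show ?thesis by (rule BseqI')
qed

lemma Bseq_adj: "Bseq x \<Longrightarrow> Bseq (\<lambda>n. adj (x n :: 'd::cstar_algebra))"
  by (simp add: Bseq_def)

lemma Bseq_scaleC: "Bseq x \<Longrightarrow> Bseq (\<lambda>n. c *\<^sub>C (x n :: 'd::cstar_algebra))"
proof -
  assume "Bseq x"
  then obtain K where K: "\<And>n. norm (x n) \<le> K" by (auto simp: Bseq_def)
  show ?thesis
    by (rule BseqI'[of _ "cmod c * K"]) (simp add: norm_scaleC K mult_left_mono)
qed

lemma tendsto_zero_adj: "x \<longlonglongrightarrow> 0 \<Longrightarrow> (\<lambda>n. adj (x n :: 'd::cstar_algebra)) \<longlonglongrightarrow> 0"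
  by (simp add: tendsto_iff dist_norm)

lemma tendsto_zero_scaleC: "x \<longlonglongrightarrow> 0 \<Longrightarrow> (\<lambda>n. c *\<^sub>C (x n :: 'd::cstar_algebra)) \<longlonglongrightarrow> 0"
  by (rule tendsto_norm_zero_cancel) (auto simp: norm_scaleC intro!: tendsto_mult_right_zero tendsto_norm_zero)

instantiation linf :: (cstar_algebra) star_algebra
begin
lift_definition zero_linf :: "'a linf" is "\<lambda>_. 0" by simp
lift_definition one_linf :: "'a linf" is "\<lambda>_. 1" by simp
lift_definition plus_linf :: "'a linf \<Rightarrow> 'a linf \<Rightarrow> 'a linf" is "\<lambda>x y n. x n + y n"
  by (auto simp: add_diff_add Bseq_add_same intro!: tendsto_add_zero)
lift_definition uminus_linf :: "'a linf \<Rightarrow> 'a linf" is "\<lambda>x n. - x n"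
proof safe
  fix x y :: "nat \<Rightarrow> 'a"
  assume *: "Bseq x" "Bseq y" "(\<lambda>n. x n - y n) \<longlonglongrightarrow> 0"
  show "Bseq (\<lambda>n. - x n)" "Bseq (\<lambda>n. - y n)" using * by (simp_all add: Bseq_minus_iff)
  show "(\<lambda>n. - x n - - y n) \<longlonglongrightarrow> 0"
    using tendsto_minus[OF *(3)] by (simp add: algebra_simps)
qed
lift_definition minus_linf :: "'a linf \<Rightarrow> 'a linf \<Rightarrow> 'a linf" is "\<lambda>x y n. x n - y n"
proof safe
  fix x x' y y' :: "nat \<Rightarrow> 'a"
  assume *: "Bseq x" "Bseq x'" "Bseq y" "Bseq y'"
    "(\<lambda>n. x n - x' n) \<longlonglongrightarrow> 0" "(\<lambda>n. y n - y' n) \<longlonglongrightarrow> 0"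
  show "Bseq (\<lambda>n. x n - y n)" "Bseq (\<lambda>n. x' n - y' n)"
    using * by (simp_all add: Bseq_diff_same)
  show "(\<lambda>n. (x n - y n) - (x' n - y' n)) \<longlonglongrightarrow> 0"
    using tendsto_diff[OF *(5,6)] by (simp add: algebra_simps)
qed
lift_definition times_linf :: "'a linf \<Rightarrow> 'a linf \<Rightarrow> 'a linf" is "\<lambda>x y n. x n * y n"
proof safe
  fix x x' y y' :: "nat \<Rightarrow> 'a"
  assume *: "Bseq x" "Bseq x'" "Bseq y" "Bseq y'"
    "(\<lambda>n. x n - x' n) \<longlonglongrightarrow> 0" "(\<lambda>n. y n - y' n) \<longlonglongrightarrow> 0"
  show "Bseq (\<lambda>n. x n * y n)" "Bseq (\<lambda>n. x' n * y' n)"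
    using * by (simp_all add: Bseq_mult_same)
  have "(\<lambda>n. (x n - x' n) * y n) \<longlonglongrightarrow> 0" "(\<lambda>n. x' n * (y n - y' n)) \<longlonglongrightarrow> 0"
    using *
      bounded_bilinear.Zfun_prod_Bfun[OF bounded_bilinear_mult]
      bounded_bilinear.Bfun_prod_Zfun[OF bounded_bilinear_mult]
    by (simp_all add: tendsto_Zfun_iff)
  from tendsto_add[OF this] show "(\<lambda>n. x n * y n - x' n * y' n) \<longlonglongrightarrow> 0"
    by (simp add: algebra_simps)
qed
lift_definition scaleC_linf :: "complex \<Rightarrow> 'a linf \<Rightarrow> 'a linf" is "\<lambda>c x n. c *\<^sub>C x n"
  by (auto simp: Bseq_scaleC simp flip: complex_vector.scale_right_diff_distrib intro!: tendsto_zero_scaleC)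
lift_definition adj_linf :: "'a linf \<Rightarrow> 'a linf" is "\<lambda>x n. adj (x n)"
  by (auto simp: Bseq_adj simp flip: adj_diff intro!: tendsto_zero_adj)
instance
proof
  show "(0 :: 'a linf) \<noteq> 1" by transfer (simp add: tendsto_const_iff)
next
  fix x :: "'a linf"
  show "- x + x = 0" by transfer simp
next
  fix x y :: "'a linf"
  show "x - y = x + - y" by transfer (simp add: Bseq_diff_same)
qed (transfer; simp add: Bseq_adj Bseq_scaleC Bseq_mult_same Bseq_add_same algebra_simps
    scaleC_add_right scaleC_add_left mult_scaleC_left mult_scaleC_right adj_add adj_scaleC
    adj_mult adj_adj)+
end

definition const_linf :: "'d::cstar_algebra \<Rightarrow> 'd linf" where
  "const_linf d = seq_class (\<lambda>_. d)"

text \<open>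
  The identification of $l^\infty(\mathbb{N}, D \otimes K)/c_0(D \otimes K)$ with
  $D^\infty \otimes K$ for finite dimensional $K$: the sequence \<open>X\<close> in $D \otimes K$ represents \<open>t\<close>.
\<close>

definition represents :: "(nat \<Rightarrow> ('d::cstar_algebra, 'k::complex_vector) tensor) \<Rightarrow> ('d linf, 'k) tensor \<Rightarrow> bool" where
  "represents X t \<longleftrightarrow> (\<exists>(m::nat) d k. (\<forall>i<m. Bseq (d i)) \<and>
     (\<forall>n. X n = (\<Sum>i<m. d i n \<otimes>\<^sub>t k i)) \<and> t = (\<Sum>i<m. seq_class (d i) \<otimes>\<^sub>t k i))"

definition coaction_infty :: "('d::cstar_algebra \<Rightarrow> ('d, 'k::complex_vector) tensor)
    \<Rightarrow> 'd linf \<Rightarrow> ('d linf, 'k) tensor" where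
  "coaction_infty \<beta> x = (THE t. \<exists>d. Bseq d \<and> x = seq_class d \<and> represents (\<lambda>n. \<beta> (d n)) t)"

definition approximately_representable :: "('k::complex_vector) hopf
    \<Rightarrow> ('d::cstar_algebra \<Rightarrow> ('d, 'k) tensor) \<Rightarrow> bool" where
  "approximately_representable K \<beta> \<longleftrightarrow> (\<exists>w :: ('d linf, 'k) tensor.
     let T = tensor_alg class_alg K; T2 = tensor_alg T K in
       unitary_in T w \<and>
       (\<forall>d. tmap const_linf id (\<beta> d) = mult T (mult T w (const_linf d \<otimes>\<^sub>t unit K)) (star T w)) \<and>
       assoc (mult T2 (w \<otimes>\<^sub>t unit K) (tmap (\<lambda>d. d \<otimes>\<^sub>t unit K) id w)) = tmap id (comult K) w \<and>
       assoc (mult T2 (tmap (coaction_infty \<beta>) id w) (w \<otimes>\<^sub>t unit K)) = tmap id (comult K) w)"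

end

theory Submission
  imports Defs
begin

text \<open>
  Since $H$ is finite dimensional, a tensor $t \in D \otimes H^0$ is the same as the linear map
  $\hat t : H \to D$, $\hat t(h) = (\mathrm{id} \otimes h)(t)$. The product of $H^0$ is dual to the
  comultiplication of $H$, so multiplication of tensors becomes the convolution
  $(p * q)(h) = p(h_{(1)}) q(h_{(2)})$, and $\mathrm{id} \otimes \Delta^0$ becomes
  $\hat t \mapsto ((x, y) \mapsto \hat t(x y))$. Under this dictionary a tensor $w$ with
  $\hat w = W$ a unital *-homomorphism is automatically unitary, because $\hat{w^*} = W \circ S$ is
  the convolution inverse of $W$, and the condition
  $w_{12} w_{13} = (\mathrm{id} \otimes \Delta^0)(w)$ says $W(x) W(y) = W(xy)$.

  The map belonging to $u_n$ is a unital *-homomorphism: $V$ belongs to $h \mapsto 1^0 \rtimes h$,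
  so $u_n$ belongs to the convolution product of $n$ copies of it in different tensor factors, and
  convolution products of *-homomorphisms with commuting ranges are *-homomorphisms
  (\<open>star_rep_conv\<close>, \<open>partial_product_rep\<close>). Composing with the embedding of $A_n$ into the limit
  gives *-homomorphisms $U_n : H \to B$ with
  \[ \hat{\rho(b)}(h) = U_n(h_{(1)}) \, b \, U_n(S(h_{(2)})) \quad \mbox{for } b \in A_n. \]
  They are uniformly bounded (\<open>star_rep_uniformly_bounded\<close>), so the sequence $(U_n)$ is a
  *-homomorphism $W : H \to B^\infty$, which yields the unitary $w$. By density of
  $\bigcup_n A_n$, boundedness and continuity of $\rho$, the displayed formula holds
  asymptotically for every $b \in B$ (\<open>asymptotically_inner_dense\<close>), so $w$ implements $\rho$. As
  $U_n(y)$ itself lies in $A_n$, the formula applies to $b = U_n(y)$ for each $n$, and the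
  condition on $\rho^\infty$ becomes $W(x_{(1)}) W(y) W(S(x_{(2)})) W(x_{(3)}) = W(x) W(y)$, the antipode law. These
  verifications are collected in \<open>approximately_representable_criterion\<close>.
\<close>

section \<open>Linear maps and elementary tensors\<close>

lemma clinear_simps:
  assumes "clinear f"
  shows "f (x + y) = f x + f y" "f (c *\<^sub>C x) = c *\<^sub>C f x" "f 0 = 0"
    "f (- x) = - f x" "f (x - y) = f x - f y"
proof -
  interpret Vector_Spaces.linear scaleC scaleC f by fact
  show "f (x + y) = f x + f y" "f (c *\<^sub>C x) = c *\<^sub>C f x" "f 0 = 0"
    "f (- x) = - f x" "f (x - y) = f x - f y"
    by (fact add scale zero neg diff)+
qed

lemma clinear_sum:
  assumes "clinear f"
  shows "f (\<Sum>i\<in>I. g i) = (\<Sum>i\<in>I. f (g i))"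
proof -
  interpret Vector_Spaces.linear scaleC scaleC f by fact
  show ?thesis by (fact sum)
qed

lemma clinear_compose: "clinear g \<Longrightarrow> clinear f \<Longrightarrow> clinear (\<lambda>x. g (f x))"
  by (simp add: clinear_iff)

text \<open>
  Values of the lifting operators on elementary tensors are available only after multilinearity
  has been checked; the rules collected here discharge these side conditions.
\<close>

named_theorems linear_intros

lemma clinear_basic [linear_intros]:
  "clinear (\<lambda>x. x)" "clinear (\<lambda>x. 0)"
  "clinear f \<Longrightarrow> clinear g \<Longrightarrow> clinear (\<lambda>x. f x + g x)"
  "clinear f \<Longrightarrow> clinear (\<lambda>x. c *\<^sub>C f x)"
  "clinear f' \<Longrightarrow> clinear (\<lambda>x. f' x *\<^sub>C v)"
  "clinear f' \<Longrightarrow> clinear (\<lambda>x. f' x * c)"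
  "clinear f' \<Longrightarrow> clinear (\<lambda>x. c * f' x)"
  for f' :: "'a::complex_vector \<Rightarrow> complex"
  by (auto simp: clinear_iff scaleC_add_right scaleC_add_left algebra_simps)

lemma clinear_id [linear_intros]: "clinear id"
  by (simp add: clinear_iff)

lemma clinear_setsum [linear_intros]:
  "(\<And>i. i \<in> I \<Longrightarrow> clinear (f i)) \<Longrightarrow> clinear (\<lambda>x. \<Sum>i\<in>I. f i x)"
  by (auto simp: clinear_iff sum.distrib complex_vector.scale_sum_right)

lemma clinear_mult [linear_intros]:
  fixes f :: "'a::complex_vector \<Rightarrow> 'b::star_algebra"
  assumes "clinear f"
  shows "clinear (\<lambda>x. f x * a)" "clinear (\<lambda>x. a * f x)"
  using assms by (auto simp: clinear_iff algebra_simps mult_scaleC_left mult_scaleC_right)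

lemma tensor_relations_gen:
  "gen (a + a', b) - gen (a, b) - gen (a', b) \<in> tensor_relations"
  "gen (a, b + b') - gen (a, b) - gen (a, b') \<in> tensor_relations"
  "gen (c *\<^sub>C a, b) - c *\<^sub>C gen (a, b) \<in> tensor_relations"
  "gen (a, c *\<^sub>C b) - c *\<^sub>C gen (a, b) \<in> tensor_relations"
  unfolding tensor_relations_def by (rule complex_vector.span_base; blast)+

lemma tensor_add_left: "(a + a') \<otimes>\<^sub>t b = a \<otimes>\<^sub>t b + a' \<otimes>\<^sub>t b"
  by transfer (use tensor_relations_gen(1) in \<open>simp add: algebra_simps\<close>)

lemma tensor_add_right: "a \<otimes>\<^sub>t (b + b') = a \<otimes>\<^sub>t b + a \<otimes>\<^sub>t b'"
  by transfer (use tensor_relations_gen(2) in \<open>simp add: algebra_simps\<close>)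

lemma tensor_scale_left: "(c *\<^sub>C a) \<otimes>\<^sub>t b = c *\<^sub>C (a \<otimes>\<^sub>t b)"
  by transfer (rule tensor_relations_gen)

lemma tensor_scale_right: "a \<otimes>\<^sub>t (c *\<^sub>C b) = c *\<^sub>C (a \<otimes>\<^sub>t b)"
  by transfer (rule tensor_relations_gen)

lemmas tensor_simps = tensor_add_left tensor_add_right tensor_scale_left tensor_scale_right

lemma clinear_tensor [linear_intros]:
  "clinear f \<Longrightarrow> clinear (\<lambda>x. f x \<otimes>\<^sub>t b)"
  "clinear f \<Longrightarrow> clinear (\<lambda>x. a \<otimes>\<^sub>t f x)"
  by (auto simp: clinear_iff tensor_simps)

lemma free_vector_space_induct [case_names zero gen add]:
  fixes r :: "'x \<Rightarrow>\<^sub>0 complex"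
  assumes zero: "P 0" and gen: "\<And>c x. P (c *\<^sub>C gen x)" and add: "\<And>r s. P r \<Longrightarrow> P s \<Longrightarrow> P (r + s)"
  shows "P r"
proof -
  have "r = (\<Sum>k\<in>Poly_Mapping.keys r. Poly_Mapping.lookup r k *\<^sub>C gen k)"
    by (rule poly_mapping_eqI)
      (simp add: lookup_sum lookup_single when_def if_distrib[of "\<lambda>x. _ * x"] in_keys_iff cong: if_cong)
  moreover have "P (\<Sum>k\<in>I. Poly_Mapping.lookup r k *\<^sub>C gen k)" for I
    by (induction I rule: infinite_finite_induct) (simp_all add: zero gen add)
  ultimately show ?thesis by metis
qed

text \<open>Scalars can be moved into an elementary tensor, so sums of elementary tensors suffice.\<close>

lemma tensor_induct [case_names elem add]:
  assumes elem: "\<And>a b. P (a \<otimes>\<^sub>t b)" and add: "\<And>s t. P s \<Longrightarrow> P t \<Longrightarrow> P (s + t)"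
  shows "P t"
proof -
  have gen: "P (abs_tensor (c *\<^sub>C gen x))" for c x
  proof -
    obtain a b where "x = (a, b)" by (cases x)
    then have "abs_tensor (c *\<^sub>C gen x) = c *\<^sub>C (a \<otimes>\<^sub>t b)"
      by (simp only: tensor.abs_eq scaleC_tensor.abs_eq)
    also have "\<dots> = (c *\<^sub>C a) \<otimes>\<^sub>t b"
      by (rule tensor_scale_left [symmetric])
    finally show ?thesis by (simp only: elem)
  qed
  obtain r where t: "t = abs_tensor r"
    by (metis Quotient3_abs_rep[OF Quotient3_tensor])
  have "P (abs_tensor r)"
  proof (induction r rule: free_vector_space_induct)
    case zero
    then show ?case using gen[of 0] by simp
  qed (simp_all add: gen add flip: plus_tensor.abs_eq)
  with t show ?thesis by simp
qed

lemma clinear_tensor_eqI: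
  assumes "clinear f" "clinear g" "\<And>a b. f (a \<otimes>\<^sub>t b) = g (a \<otimes>\<^sub>t b)"
  shows "f t = g t"
  by (induction t rule: tensor_induct) (simp_all add: assms(3) clinear_simps[OF assms(1)] clinear_simps[OF assms(2)])

lemma clinear_tlift [linear_intros]:
  assumes "\<And>a. clinear (f a)" "\<And>b. clinear (\<lambda>a. f a b)" "clinear g"
  shows "clinear (\<lambda>x. tlift f (g x))"
  by (rule clinear_compose[OF tlift_linear[OF assms(1,2)] assms(3)])

lemma clinear_tlift_param [linear_intros]:
  assumes "\<And>a b. clinear (\<lambda>x. F x a b)"
  shows "clinear (\<lambda>x. tlift (F x) t)"
  unfolding tlift_def lin_ext_def using assms
  by (auto intro!: linear_intros simp: case_prod_beta)

lemma clinear_apply_tlift: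
  assumes g: "clinear g" and f: "\<And>a. clinear (f a)" "\<And>b. clinear (\<lambda>a. f a b)"
  shows "g (tlift f t) = tlift (\<lambda>a b. g (f a b)) t"
  by (rule clinear_tensor_eqI)
    (auto intro!: linear_intros clinear_compose[OF g] simp: f tlift_tensor clinear_compose[OF g])

lemma clinear_tmap [linear_intros]:
  "clinear f \<Longrightarrow> clinear g \<Longrightarrow> clinear h \<Longrightarrow> clinear (\<lambda>x. tmap f g (h x))"
  unfolding tmap_def by (auto intro!: linear_intros intro: clinear_compose[of f] clinear_compose[of g])

lemma tmap_tensor: "clinear f \<Longrightarrow> clinear g \<Longrightarrow> tmap f g (a \<otimes>\<^sub>t b) = f a \<otimes>\<^sub>t g b"
  unfolding tmap_def by (subst tlift_tensor) (auto intro!: linear_intros)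

lemma clinear_assoc [linear_intros]: "clinear f \<Longrightarrow> clinear (\<lambda>x. assoc (f x))"
  unfolding assoc_def by (auto intro!: linear_intros)

lemma assoc_tensor: "assoc ((a \<otimes>\<^sub>t b) \<otimes>\<^sub>t c) = a \<otimes>\<^sub>t (b \<otimes>\<^sub>t c)"
  unfolding assoc_def by (simp add: tlift_tensor linear_intros)

definition conj_linear :: "('a::complex_vector \<Rightarrow> 'b::complex_vector) \<Rightarrow> bool" where
  "conj_linear f \<longleftrightarrow> (\<forall>x y. f (x + y) = f x + f y) \<and> (\<forall>c x. f (c *\<^sub>C x) = cnj c *\<^sub>C f x)"

lemma conj_linear_tlift_conj:
  assumes "\<And>a. conj_linear (f a)" "\<And>b. conj_linear (\<lambda>a. f a b)"
  shows "conj_linear (tlift_conj f)" "tlift_conj f (a \<otimes>\<^sub>t b) = f a b"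
proof -
  have *: "\<And>a b b'. f a (b + b') = f a b + f a b'" "\<And>a a' b. f (a + a') b = f a b + f a' b"
    "\<And>c a b. f (c *\<^sub>C a) b = cnj c *\<^sub>C f a b" "\<And>c a b. f a (c *\<^sub>C b) = cnj c *\<^sub>C f a b"
    using assms by (auto simp: conj_linear_def)
  show "conj_linear (tlift_conj f)"
    by (auto simp: conj_linear_def tlift_conj_add_scaleC[OF *])
  show "tlift_conj f (a \<otimes>\<^sub>t b) = f a b"
    by (rule tlift_conj_tensor[OF *])
qed

lemma conj_linear_tlift_conj_param:
  assumes "\<And>a b. conj_linear (\<lambda>x. F x a b)"
  shows "conj_linear (\<lambda>x. tlift_conj (F x) t)"
  unfolding tlift_conj_def conj_ext_def using assms
  by (auto simp: conj_linear_def case_prod_beta sum.distrib scaleC_add_right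
      complex_vector.scale_sum_right mult.commute)

lemma conj_linear_compose:
  "conj_linear g \<Longrightarrow> clinear f \<Longrightarrow> conj_linear (\<lambda>x. g (f x))"
  "clinear f' \<Longrightarrow> conj_linear g' \<Longrightarrow> conj_linear (\<lambda>x. f' (g' x))"
  by (auto simp: conj_linear_def clinear_iff)

section \<open>Tensors with a dual factor as linear maps\<close>

lemma clinear_app [linear_intros]: "clinear (app \<phi>)"
  using app by auto

lemma clinear_app_arg [linear_intros]:
  "clinear f \<Longrightarrow> clinear (\<lambda>x. app (f x) h)"
  "clinear g \<Longrightarrow> clinear (\<lambda>x. app \<phi> (g x))"
  by (simp_all add: clinear_iff plus_dual.rep_eq scaleC_dual.rep_eq clinear_simps[OF clinear_app])

lemma app_Dual: "clinear f \<Longrightarrow> app (Dual f) = f"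
  by (simp add: Dual_inverse)

lemma dual_eqI: "(\<And>h. app \<phi> h = app \<psi> h) \<Longrightarrow> \<phi> = \<psi>"
  by (metis app_inject ext)

text \<open>
  The slices of \<open>t\<close> by the elements of \<open>H\<close> form the linear map $\hat t$; elements of
  $D \otimes (H^0 \otimes H^0)$ likewise give bilinear maps $H \times H \to D$, in which the two
  sides of the corepresentation conditions are compared.
\<close>

definition hat :: "('d::complex_vector, 'h::complex_vector dual) tensor \<Rightarrow> 'h \<Rightarrow> 'd" where
  "hat t h = slice (\<lambda>\<phi>. app \<phi> h) t"

definition hat2 :: "('d::complex_vector, ('h::complex_vector dual, 'h dual) tensor) tensor \<Rightarrow> 'h \<Rightarrow> 'h \<Rightarrow> 'd" where
  "hat2 r x y = tlift (\<lambda>d t. tlift (\<lambda>\<phi> \<psi>. app \<phi> x * app \<psi> y) t *\<^sub>C d) r"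

lemma clinear_hat [linear_intros]:
  "clinear f \<Longrightarrow> clinear (\<lambda>x. hat (f x) h)" "clinear g \<Longrightarrow> clinear (\<lambda>x. hat t (g x))"
  unfolding hat_def slice_def by (auto intro!: linear_intros)

lemma hat_tensor: "hat (d \<otimes>\<^sub>t \<phi>) h = app \<phi> h *\<^sub>C d"
  unfolding hat_def slice_def by (subst tlift_tensor) (auto intro!: linear_intros)

lemma clinear_hat2 [linear_intros]: "clinear f \<Longrightarrow> clinear (\<lambda>z. hat2 (f z) x y)"
  unfolding hat2_def by (auto intro!: linear_intros)

lemma hat2_tensor: "hat2 (d \<otimes>\<^sub>t t) x y = tlift (\<lambda>\<phi> \<psi>. app \<phi> x * app \<psi> y) t *\<^sub>C d"
  unfolding hat2_def by (subst tlift_tensor) (auto intro!: linear_intros)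

lemma tlift_app_app [simp]: "tlift (\<lambda>\<phi> \<psi>. app \<phi> x * app \<psi> y) (\<phi> \<otimes>\<^sub>t \<psi>) = app \<phi> x * app \<psi> y"
  by (subst tlift_tensor) (auto intro!: linear_intros)

text \<open>
  The outermost factor of $(D \otimes H^0) \otimes H^0$ is sliced first and corresponds to the
  second argument.
\<close>

lemma hat2_assoc: "hat2 (assoc s) x y = hat (hat s y) x"
proof (rule clinear_tensor_eqI[where t = s])
  fix t \<psi>
  show "hat2 (assoc (t \<otimes>\<^sub>t \<psi>)) x y = hat (hat (t \<otimes>\<^sub>t \<psi>) y) x"
    by (rule clinear_tensor_eqI[where t = t])
      (auto intro!: linear_intros simp: assoc_tensor hat2_tensor hat_tensor clinear_simps[OF clinear_hat(1)[OF clinear_basic(1)]])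
qed (auto intro!: linear_intros)

lemma hat_tmap:
  assumes "clinear f"
  shows "hat (tmap f id t) h = f (hat t h)"
  by (rule clinear_tensor_eqI[where t = t])
    (auto intro!: linear_intros clinear_compose[OF assms] simp: assms tmap_tensor hat_tensor clinear_simps[OF assms] clinear_basic(1) id_def)

subsection \<open>Products of tensors\<close>

definition cbilinear :: "('a::complex_vector \<Rightarrow> 'b::complex_vector \<Rightarrow> 'c::complex_vector) \<Rightarrow> bool" where
  "cbilinear f \<longleftrightarrow> (\<forall>a. clinear (f a)) \<and> (\<forall>b. clinear (\<lambda>a. f a b))"

lemma cbilinear_clinear:
  "cbilinear f \<Longrightarrow> clinear g \<Longrightarrow> clinear (\<lambda>x. f a (g x))"
  "cbilinear f \<Longrightarrow> clinear g' \<Longrightarrow> clinear (\<lambda>x. f (g' x) b)"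
  by (auto simp: cbilinear_def clinear_iff)

lemma tensor_alg_mult_tensor:
  assumes "cbilinear (mult A)" "cbilinear (mult B)"
  shows "mult (tensor_alg A B) (a \<otimes>\<^sub>t b) (a' \<otimes>\<^sub>t b') = mult A a a' \<otimes>\<^sub>t mult B b b'"
  unfolding tensor_alg_def by (simp add: tlift_tensor linear_intros assms[THEN cbilinear_clinear(1)] assms[THEN cbilinear_clinear(2)])

lemma cbilinear_tensor_alg:
  assumes "cbilinear (mult A)" "cbilinear (mult B)"
  shows "cbilinear (mult (tensor_alg A B))"
  unfolding tensor_alg_def cbilinear_def
  by (auto intro!: linear_intros assms[THEN cbilinear_clinear(1)] assms[THEN cbilinear_clinear(2)])

lemma tlift_tensor_alg_mult:
  assumes AB: "cbilinear (mult A)" "cbilinear (mult B)" and f: "cbilinear f"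
  shows "tlift f (mult (tensor_alg A B) s t) =
    tlift (\<lambda>a b. tlift (\<lambda>a' b'. f (mult A a a') (mult B b b')) t) s"
proof (rule clinear_tensor_eqI[where t = s])
  note intros = linear_intros AB[THEN cbilinear_clinear(1)] AB[THEN cbilinear_clinear(2)]
    cbilinear_tensor_alg[OF AB, THEN cbilinear_clinear(1)] cbilinear_tensor_alg[OF AB, THEN cbilinear_clinear(2)]
    f[THEN cbilinear_clinear(1)] f[THEN cbilinear_clinear(2)]
  show "clinear (\<lambda>s. tlift f (mult (tensor_alg A B) s t))"
    "clinear (tlift (\<lambda>a b. tlift (\<lambda>a' b'. f (mult A a a') (mult B b b')) t))"
    by (auto intro!: intros)
  fix a b
  show "tlift f (mult (tensor_alg A B) (a \<otimes>\<^sub>t b) t) =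
    tlift (\<lambda>a b. tlift (\<lambda>a' b'. f (mult A a a') (mult B b b')) t) (a \<otimes>\<^sub>t b)"
    by (rule clinear_tensor_eqI[where t = t])
      (auto intro!: intros simp: tensor_alg_mult_tensor[OF AB] tlift_tensor intros)
qed

lemma conj_linear_tensor:
  "conj_linear f \<Longrightarrow> conj_linear (\<lambda>x. f x \<otimes>\<^sub>t b)"
  "conj_linear f \<Longrightarrow> conj_linear (\<lambda>x. a \<otimes>\<^sub>t f x)"
  by (auto simp: conj_linear_def tensor_simps)

lemma tensor_alg_star_tensor:
  assumes "conj_linear (star A)" "conj_linear (star B)"
  shows "star (tensor_alg A B) (a \<otimes>\<^sub>t b) = star A a \<otimes>\<^sub>t star B b"
    and "conj_linear (star (tensor_alg A B))"
  unfolding tensor_alg_def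
  using assms by (simp_all add: conj_linear_tlift_conj conj_linear_tensor)

lemma cbilinear_class_alg: "cbilinear (mult class_alg)"
  by (auto simp: class_alg_def cbilinear_def intro!: linear_intros)

lemma conj_linear_adj: "conj_linear (star class_alg)"
  by (auto simp: class_alg_def conj_linear_def adj_add adj_scaleC)

section \<open>The dual Hopf algebra in coordinates\<close>

text \<open>
  A finite spanning set \<open>B\<close> of \<open>H\<close> with coordinate functionals \<open>e b\<close>. Fixing it once makes the
  identification of $D \otimes H^0$ with the linear maps from \<open>H\<close> to \<open>D\<close> explicit:
  \<open>tensor_expansion\<close> recovers a tensor from its linear map and \<open>hat_of_map\<close> gives the converse.
\<close>

locale hopf_coordinates =
  fixes H :: "('h::complex_vector) hopf" and B :: "'h set" and e :: "'h \<Rightarrow> 'h dual"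
  assumes cstar_hopf: "cstar_hopf_algebra H"
    and finite_B: "finite B"
    and expansion: "\<And>h. (\<Sum>b\<in>B. app (e b) h *\<^sub>C b) = h"

lemma coordinates_exist:
  assumes "cstar_hopf_algebra (H :: ('h::complex_vector) hopf)"
  shows "\<exists>B e. hopf_coordinates H B e"
proof -
  obtain S where S: "finite S" "complex_vector.span S = (UNIV :: 'h set)"
    using assms by (auto simp: cstar_hopf_algebra_def finite_dim_cstar_algebra_def)
  obtain B where B: "B \<subseteq> S" "complex_vector.independent B" "S \<subseteq> complex_vector.span B"
    using complex_vector.maximal_independent_subset by blast
  have span: "v \<in> complex_vector.span B" for v
    using complex_vector.span_mono[OF B(3)] S(2) by (metis UNIV_I complex_vector.span_span subsetD)
  define e where "e b = Dual (\<lambda>v. complex_vector.representation B v b)" for b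
  have "app (e b) v = complex_vector.representation B v b" for b v
    unfolding e_def
    by (subst app_Dual)
      (auto simp: clinear_iff complex_vector.representation_add complex_vector.representation_scale B(2) span)
  then have "hopf_coordinates H B e"
    using assms B S by unfold_locales
      (auto simp: finite_subset complex_vector.sum_representation_eq span)
  then show ?thesis by blast
qed

context hopf_coordinates
begin

lemma star_algebra_H: "is_star_algebra H"
  using cstar_hopf by (simp add: cstar_hopf_algebra_def finite_dim_cstar_algebra_def)

lemma cbilinear_H: "cbilinear (mult H)"
  using star_algebra_H by (simp add: is_star_algebra_def cbilinear_def)

lemma clinear_Hopf:
  "clinear (comult H)" "clinear (counit H)" "clinear (antipode H)"
  using cstar_hopf by (simp_all add: cstar_hopf_algebra_def unital_star_hom_on_def)

lemmas clinear_Hopf_compose [linear_intros] =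
  clinear_Hopf clinear_Hopf[THEN clinear_compose]
  cbilinear_H[THEN cbilinear_clinear(1)] cbilinear_H[THEN cbilinear_clinear(2)]

lemma conj_linear_star_H: "conj_linear (star H)"
  using star_algebra_H by (simp add: is_star_algebra_def conj_linear_def)

lemma star_H_simps:
  "star H (star H x) = x" "star H (mult H x y) = mult H (star H y) (star H x)"
  "mult H (unit H) x = x" "mult H x (unit H) = x"
  "mult H (mult H x y) z = mult H x (mult H y z)"
  using star_algebra_H by (simp_all add: is_star_algebra_def)

lemma counit_hom:
  "counit H (unit H) = 1" "counit H (mult H x y) = counit H x * counit H y"
  "counit H (star H x) = cnj (counit H x)"
  using cstar_hopf by (simp_all add: cstar_hopf_algebra_def unital_star_hom_on_def complex_alg_def)

lemma comult_hom:
  "comult H (unit H) = unit H \<otimes>\<^sub>t unit H"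
  "comult H (mult H x y) = mult (tensor_alg H H) (comult H x) (comult H y)"
  "comult H (star H x) = star (tensor_alg H H) (comult H x)"
  using cstar_hopf by (simp_all add: cstar_hopf_algebra_def unital_star_hom_on_def tensor_alg_def)

lemma dual_expansion: "(\<Sum>b\<in>B. app \<phi> b *\<^sub>C e b) = \<phi>"
proof (rule dual_eqI)
  fix h
  have "app (\<Sum>b\<in>B. app \<phi> b *\<^sub>C e b) h = (\<Sum>b\<in>B. app \<phi> (app (e b) h *\<^sub>C b))"
    by (subst clinear_sum[where f = "\<lambda>\<phi>. app \<phi> h"])
      (auto intro!: linear_intros sum.cong simp: scaleC_dual.rep_eq clinear_simps[OF clinear_app])
  also have "\<dots> = app \<phi> h"
    by (simp add: expansion flip: clinear_sum[OF clinear_app])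
  finally show "app (\<Sum>b\<in>B. app \<phi> b *\<^sub>C e b) h = app \<phi> h" .
qed

lemma tensor_expansion: "(\<Sum>b\<in>B. hat t b \<otimes>\<^sub>t e b) = t"
proof (rule clinear_tensor_eqI[where t = t])
  fix d \<phi>
  have "d \<otimes>\<^sub>t \<phi> = d \<otimes>\<^sub>t (\<Sum>b\<in>B. app \<phi> b *\<^sub>C e b)" by (simp add: dual_expansion)
  also have "\<dots> = (\<Sum>b\<in>B. hat (d \<otimes>\<^sub>t \<phi>) b \<otimes>\<^sub>t e b)"
    by (subst clinear_sum[where f = "\<lambda>\<phi>. d \<otimes>\<^sub>t \<phi>"])
      (auto intro!: linear_intros simp: hat_tensor tensor_simps)
  finally show "(\<Sum>b\<in>B. hat (d \<otimes>\<^sub>t \<phi>) b \<otimes>\<^sub>t e b) = d \<otimes>\<^sub>t \<phi>" by simp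
qed (auto intro!: linear_intros)

lemma hat_eqI:
  fixes s t :: "('d::complex_vector, 'h dual) tensor"
  assumes "\<And>h. hat s h = hat t h"
  shows "s = t"
  by (metis (no_types, lifting) assms sum.cong tensor_expansion)

lemma hat_of_map:
  assumes "clinear f"
  shows "hat (\<Sum>b\<in>B. f b \<otimes>\<^sub>t e b) h = f h"
proof -
  have "hat (\<Sum>b\<in>B. f b \<otimes>\<^sub>t e b) h = (\<Sum>b\<in>B. f (app (e b) h *\<^sub>C b))"
    by (subst clinear_sum[where f = "\<lambda>t. hat t h"])
      (auto intro!: linear_intros simp: hat_tensor clinear_simps[OF assms])
  also have "\<dots> = f h"
    by (simp add: expansion flip: clinear_sum[OF assms])
  finally show ?thesis .
qed

lemma hat2_expansion: "(\<Sum>b\<in>B. \<Sum>c\<in>B. hat2 r b c \<otimes>\<^sub>t (e b \<otimes>\<^sub>t e c)) = r"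
proof (rule clinear_tensor_eqI[where t = r])
  fix d and t :: "('h dual, 'h dual) tensor"
  show "(\<Sum>b\<in>B. \<Sum>c\<in>B. hat2 (d \<otimes>\<^sub>t t) b c \<otimes>\<^sub>t (e b \<otimes>\<^sub>t e c)) = d \<otimes>\<^sub>t t"
  proof (rule clinear_tensor_eqI[where t = t])
    fix \<phi> \<psi>
    have "d \<otimes>\<^sub>t (\<phi> \<otimes>\<^sub>t \<psi>) = d \<otimes>\<^sub>t ((\<Sum>b\<in>B. app \<phi> b *\<^sub>C e b) \<otimes>\<^sub>t (\<Sum>c\<in>B. app \<psi> c *\<^sub>C e c))"
      by (simp only: dual_expansion)
    also have "\<dots> = (\<Sum>b\<in>B. d \<otimes>\<^sub>t ((app \<phi> b *\<^sub>C e b) \<otimes>\<^sub>t (\<Sum>c\<in>B. app \<psi> c *\<^sub>C e c)))"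
      by (rule clinear_sum) (auto intro!: linear_intros)
    also have "\<dots> = (\<Sum>b\<in>B. \<Sum>c\<in>B. d \<otimes>\<^sub>t ((app \<phi> b *\<^sub>C e b) \<otimes>\<^sub>t (app \<psi> c *\<^sub>C e c)))"
      by (intro sum.cong refl clinear_sum) (auto intro!: linear_intros)
    also have "\<dots> = (\<Sum>b\<in>B. \<Sum>c\<in>B. hat2 (d \<otimes>\<^sub>t (\<phi> \<otimes>\<^sub>t \<psi>)) b c \<otimes>\<^sub>t (e b \<otimes>\<^sub>t e c))"
      by (intro sum.cong refl) (simp add: hat2_tensor tensor_simps)
    finally show "(\<Sum>b\<in>B. \<Sum>c\<in>B. hat2 (d \<otimes>\<^sub>t (\<phi> \<otimes>\<^sub>t \<psi>)) b c \<otimes>\<^sub>t (e b \<otimes>\<^sub>t e c)) = d \<otimes>\<^sub>t (\<phi> \<otimes>\<^sub>t \<psi>)"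
      by (rule sym)
  qed (auto intro!: linear_intros)
qed (auto intro!: linear_intros)


lemma antipode_laws:
  "tlift (\<lambda>x y. mult H (antipode H x) y) (comult H k) = counit H k *\<^sub>C unit H"
  "tlift (\<lambda>x y. mult H x (antipode H y)) (comult H k) = counit H k *\<^sub>C unit H"
  using cstar_hopf by (simp_all add: cstar_hopf_algebra_def)

lemma counit_laws:
  "tlift (\<lambda>x y. counit H x *\<^sub>C y) (comult H k) = k"
  "tlift (\<lambda>x y. counit H y *\<^sub>C x) (comult H k) = k"
  using cstar_hopf by (simp_all add: cstar_hopf_algebra_def)

lemma coassociative:
  "assoc (tmap (comult H) id (comult H k)) = tmap id (comult H) (comult H k)"
  using cstar_hopf by (simp add: cstar_hopf_algebra_def)

text \<open>The counit laws under a linear map, the form in which they remove a leg of a Sweedler sum.\<close>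

lemma tlift_counit:
  assumes "clinear p"
  shows "tlift (\<lambda>x y. counit H x *\<^sub>C p y) (comult H k) = p k"
    and "tlift (\<lambda>x y. counit H y *\<^sub>C p x) (comult H k) = p k"
proof -
  have "tlift (\<lambda>x y. p (counit H x *\<^sub>C y)) (comult H k) = p (tlift (\<lambda>x y. counit H x *\<^sub>C y) (comult H k))"
    by (rule clinear_apply_tlift[symmetric]) (auto intro!: linear_intros assms)
  then show "tlift (\<lambda>x y. counit H x *\<^sub>C p y) (comult H k) = p k"
    by (simp add: counit_laws clinear_simps[OF assms])
  have "tlift (\<lambda>x y. p (counit H y *\<^sub>C x)) (comult H k) = p (tlift (\<lambda>x y. counit H y *\<^sub>C x) (comult H k))"
    by (rule clinear_apply_tlift[symmetric]) (auto intro!: linear_intros assms)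
  then show "tlift (\<lambda>x y. counit H y *\<^sub>C p x) (comult H k) = p k"
    by (simp add: counit_laws clinear_simps[OF assms])
qed

text \<open>Apply the counit to the antipode law $S(k_{(1)}) k_{(2)} = \epsilon(k) 1$.\<close>

lemma counit_antipode: "counit H (antipode H k) = counit H k"
proof -
  have "counit H (tlift (\<lambda>x y. mult H (antipode H x) y) (comult H k)) =
      tlift (\<lambda>x y. counit H (mult H (antipode H x) y)) (comult H k)"
    by (rule clinear_apply_tlift) (auto intro!: linear_intros)
  also have "\<dots> = tlift (\<lambda>x y. counit H y *\<^sub>C counit H (antipode H x)) (comult H k)"
    by (simp add: counit_hom mult.commute)
  also have "\<dots> = counit H (antipode H k)"
    by (rule tlift_counit(2)) (auto intro!: linear_intros)
  finally show ?thesis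
    by (simp add: antipode_laws clinear_simps[OF clinear_Hopf(2)] counit_hom)
qed

subsection \<open>The operations of the dual\<close>

lemma app_dual_mult: "app (mult (dual_hopf H) \<phi> \<psi>) h = tlift (\<lambda>x y. app \<phi> x * app \<psi> y) (comult H h)"
  unfolding dual_hopf_def by (simp, subst app_Dual) (auto intro!: linear_intros)

lemma app_dual_unit: "app (unit (dual_hopf H)) h = counit H h"
  unfolding dual_hopf_def by (simp, subst app_Dual) (auto intro!: linear_intros)

lemma app_dual_star: "app (star (dual_hopf H) \<phi>) h = cnj (app \<phi> (star H (antipode H h)))"
  unfolding dual_hopf_def using conj_linear_star_H
  by (simp, subst app_Dual)
    (auto simp: clinear_iff conj_linear_def clinear_simps[OF clinear_Hopf(3)] clinear_simps[OF clinear_app])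

lemma cbilinear_dual: "cbilinear (mult (dual_hopf H))"
proof -
  have "cbilinear (\<lambda>\<phi> \<psi>. tlift (\<lambda>x y. app \<phi> x * app \<psi> y) (comult H h))" for h
    unfolding cbilinear_def by (auto intro!: linear_intros)
  then show ?thesis
    unfolding cbilinear_def clinear_iff
    by (auto intro!: dual_eqI simp: app_dual_mult plus_dual.rep_eq scaleC_dual.rep_eq)
qed

lemma conj_linear_star_dual: "conj_linear (star (dual_hopf H))"
  by (auto simp: conj_linear_def app_dual_star plus_dual.rep_eq scaleC_dual.rep_eq intro!: dual_eqI)

lemma app_hat: "app (hat t l) k = tlift (\<lambda>\<psi> \<eta>. app \<psi> k * app \<eta> l) t"
  by (rule clinear_tensor_eqI[where t = t])
    (auto intro!: linear_intros simp: hat_tensor scaleC_dual.rep_eq)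

text \<open>
  The tensor with coordinates $\phi(b\,c)$ satisfies the equations defining $\Delta^0(\phi)$, and
  slices separate tensors, so the definite description in the definition of the dual is met.
\<close>

lemma app_hat_dual_comult: "app (hat (comult (dual_hopf H) \<phi>) l) k = app \<phi> (mult H k l)"
proof -
  let ?P = "\<lambda>t. \<forall>k l. tlift (\<lambda>\<psi> \<eta>. app \<psi> k * app \<eta> l) t = app \<phi> (mult H k l)"
  define f where "f l = Dual (\<lambda>k. app \<phi> (mult H k l))" for l
  have app_f: "app (f l) k = app \<phi> (mult H k l)" for k l
    unfolding f_def by (subst app_Dual) (auto intro!: linear_intros)
  have "clinear f"
    unfolding clinear_iff
    by (intro conjI allI dual_eqI)
      (simp_all only: app_f plus_dual.rep_eq scaleC_dual.rep_eq scaleC_complex_def clinear_simps[OF clinear_app]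
        clinear_simps[OF cbilinear_H[THEN cbilinear_clinear(1), OF clinear_basic(1)]])
  then have "?P (\<Sum>b\<in>B. f b \<otimes>\<^sub>t e b)"
    by (simp only: hat_of_map app_f flip: app_hat) simp
  moreover have "s = t" if "?P s" "?P t" for s t
    using that by (intro hat_eqI dual_eqI) (simp add: app_hat)
  ultimately have "\<exists>!t. ?P t" by blast
  then have "?P (THE t. ?P t)"
    by (rule theI')
  then show ?thesis
    by (simp add: app_hat dual_hopf_def)
qed

lemma clinear_dual_comult: "clinear (comult (dual_hopf H))"
  unfolding clinear_iff
  by (auto intro!: hat_eqI dual_eqI simp: app_hat_dual_comult plus_dual.rep_eq scaleC_dual.rep_eq
      clinear_simps[OF clinear_hat(1)[OF clinear_basic(1)]])

subsection \<open>The tensor product with the dual under the identification with linear maps\<close>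

text \<open>
  The product of the dual is dual to the comultiplication of \<open>H\<close>, so the product of tensors is a
  convolution of the linear maps, taken in \<open>D\<close>.
\<close>

lemma hat_mult:
  assumes D: "cbilinear (mult D)"
  shows "hat (mult (tensor_alg D (dual_hopf H)) s t) h =
    tlift (\<lambda>x y. mult D (hat s x) (hat t y)) (comult H h)"
proof (rule clinear_tensor_eqI[where t = s])
  note intros = linear_intros D[THEN cbilinear_clinear(1)] D[THEN cbilinear_clinear(2)]
    cbilinear_tensor_alg[OF D cbilinear_dual, THEN cbilinear_clinear(1)]
    cbilinear_tensor_alg[OF D cbilinear_dual, THEN cbilinear_clinear(2)]
  note D_simps = clinear_simps[OF D[THEN cbilinear_clinear(1), OF clinear_basic(1)]]
    clinear_simps[OF D[THEN cbilinear_clinear(2), OF clinear_basic(1)]]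
  show "clinear (\<lambda>s. hat (mult (tensor_alg D (dual_hopf H)) s t) h)"
    "clinear (\<lambda>s. tlift (\<lambda>x y. mult D (hat s x) (hat t y)) (comult H h))"
    by (auto intro!: intros)
  fix a \<phi>
  show "hat (mult (tensor_alg D (dual_hopf H)) (a \<otimes>\<^sub>t \<phi>) t) h =
    tlift (\<lambda>x y. mult D (hat (a \<otimes>\<^sub>t \<phi>) x) (hat t y)) (comult H h)"
  proof (rule clinear_tensor_eqI[where t = t])
    fix b \<psi>
    have "tlift (\<lambda>x y. app \<phi> x * app \<psi> y) (comult H h) *\<^sub>C mult D a b =
        tlift (\<lambda>x y. (app \<phi> x * app \<psi> y) *\<^sub>C mult D a b) (comult H h)"
      by (rule clinear_apply_tlift) (auto intro!: intros)
    then show "hat (mult (tensor_alg D (dual_hopf H)) (a \<otimes>\<^sub>t \<phi>) (b \<otimes>\<^sub>t \<psi>)) h =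
      tlift (\<lambda>x y. mult D (hat (a \<otimes>\<^sub>t \<phi>) x) (hat (b \<otimes>\<^sub>t \<psi>) y)) (comult H h)"
      by (simp add: tensor_alg_mult_tensor D cbilinear_dual hat_tensor app_dual_mult D_simps mult.commute)
  qed (auto intro!: intros)
qed

text \<open>The antipode enters through the involution $\phi^*(h) = \overline{\phi(S(h)^*)}$ of the dual.\<close>

lemma hat_star:
  assumes D: "conj_linear (star D)"
  shows "hat (star (tensor_alg D (dual_hopf H)) t) h = star D (hat t (star H (antipode H h)))"
proof (induction t rule: tensor_induct)
  case (elem d \<phi>)
  show ?case
    using D by (simp add: tensor_alg_star_tensor(1)[OF D conj_linear_star_dual] hat_tensor app_dual_star conj_linear_def)
next
  case (add s t)
  then show ?case
    using D tensor_alg_star_tensor(2)[OF D conj_linear_star_dual]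
    by (simp add: conj_linear_def clinear_simps[OF clinear_hat(1)[OF clinear_basic(1)]])
qed

lemma hat_tensor_unit: "hat (d \<otimes>\<^sub>t unit (dual_hopf H)) h = counit H h *\<^sub>C d"
  by (simp add: hat_tensor app_dual_unit)

lemma hat2_comult: "hat2 (tmap id (comult (dual_hopf H)) t) x y = hat t (mult H x y)"
  by (rule clinear_tensor_eqI[where t = t])
    (auto intro!: linear_intros clinear_dual_comult
      simp: tmap_tensor id_def clinear_basic(1) clinear_dual_comult hat2_tensor hat_tensor app_hat_dual_comult simp flip: app_hat)

lemma hat2_eqI:
  fixes r s :: "('d::complex_vector, ('h dual, 'h dual) tensor) tensor"
  assumes "\<And>x y. hat2 r x y = hat2 s x y"
  shows "r = s"
  by (metis (no_types, lifting) assms sum.cong hat2_expansion)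

subsection \<open>Convolution\<close>

definition conv :: "('h \<Rightarrow> 'c::star_algebra) \<Rightarrow> ('h \<Rightarrow> 'c) \<Rightarrow> 'h \<Rightarrow> 'c" where
  "conv p q h = tlift (\<lambda>x y. p x * q y) (comult H h)"

lemma clinear_conv:
  assumes "clinear p" "clinear q"
  shows "clinear (conv p q)"
  unfolding conv_def using assms by (auto intro!: linear_intros)

text \<open>
  Both sides are values of one linear map on the threefold tensor product, at the two sides of
  the coassociativity law.
\<close>

lemma conv_assoc:
  assumes p: "clinear p" and q: "clinear q" and r: "clinear r"
  shows "conv (conv p q) r h = conv p (conv q r) h"
proof -
  let ?F = "tlift (\<lambda>a t. tlift (\<lambda>b c. p a * q b * r c) t)"
  note intros = linear_intros p q r clinear_compose[OF p] clinear_compose[OF q] clinear_compose[OF r]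
    clinear_conv[OF p q] clinear_conv[OF q r]
  have F: "?F (a \<otimes>\<^sub>t t) = tlift (\<lambda>b c. p a * q b * r c) t" for a t
    by (rule tlift_tensor) (auto intro!: intros)
  have "tlift (\<lambda>x y. conv p q x * r y) t = ?F (assoc (tmap (comult H) id t))" for t
  proof (rule clinear_tensor_eqI[where t = t])
    fix x y
    have "tlift (\<lambda>b c. p b * q c) s * r y = ?F (assoc (s \<otimes>\<^sub>t y))" for s
    proof (rule clinear_tensor_eqI[where t = s])
      fix a b
      show "tlift (\<lambda>b c. p b * q c) (a \<otimes>\<^sub>t b) * r y = ?F (assoc ((a \<otimes>\<^sub>t b) \<otimes>\<^sub>t y))"
        unfolding assoc_tensor F by (simp add: tlift_tensor intros)
    qed (auto intro!: intros)
    moreover have "tlift (\<lambda>x y. conv p q x * r y) (x \<otimes>\<^sub>t y) = conv p q x * r y"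
      by (rule tlift_tensor) (auto intro!: intros)
    ultimately show "tlift (\<lambda>x y. conv p q x * r y) (x \<otimes>\<^sub>t y) = ?F (assoc (tmap (comult H) id (x \<otimes>\<^sub>t y)))"
      by (simp add: tmap_tensor conv_def clinear_Hopf clinear_id)
  qed (auto intro!: intros)
  moreover have "tlift (\<lambda>x y. p x * conv q r y) t = ?F (tmap id (comult H) t)" for t
  proof (rule clinear_tensor_eqI[where t = t])
    fix x y
    have "tlift (\<lambda>x y. p x * conv q r y) (x \<otimes>\<^sub>t y) = p x * conv q r y"
      by (rule tlift_tensor) (auto intro!: intros)
    also have "\<dots> = tlift (\<lambda>b c. p x * (q b * r c)) (comult H y)"
      unfolding conv_def by (rule clinear_apply_tlift) (auto intro!: intros)
    finally show "tlift (\<lambda>x y. p x * conv q r y) (x \<otimes>\<^sub>t y) = ?F (tmap id (comult H) (x \<otimes>\<^sub>t y))"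
      by (simp only: tmap_tensor[OF clinear_id clinear_Hopf(1)] id_apply F, simp only: mult.assoc)
  qed (auto intro!: intros)
  ultimately show ?thesis
    unfolding conv_def[of _ _ h] by (simp add: coassociative)
qed

lemma conv_counit:
  assumes "clinear p"
  shows "conv (\<lambda>x. counit H x *\<^sub>C c) p h = c * p h" "conv p (\<lambda>x. counit H x *\<^sub>C c) h = p h * c"
  using tlift_counit(1)[of "\<lambda>y. c * p y" h] tlift_counit(2)[of "\<lambda>y. p y * c" h] assms
  by (simp_all add: conv_def mult_scaleC_left mult_scaleC_right linear_intros)

subsection \<open>Unital *-homomorphisms\<close>

abbreviation star_rep :: "('h \<Rightarrow> 'c::star_algebra) \<Rightarrow> bool" where
  "star_rep \<equiv> unital_star_hom H class_alg"

lemma star_rep_simps: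
  assumes "star_rep U"
  shows "clinear U" "U (unit H) = 1" "U (mult H x y) = U x * U y" "U (star H x) = adj (U x)"
  using assms by (simp_all add: unital_star_hom_on_def class_alg_def)

lemma star_repI:
  assumes "clinear U" "U (unit H) = 1" "\<And>x y. U (mult H x y) = U x * U y" "\<And>x. U (star H x) = adj (U x)"
  shows "star_rep U"
  using assms by (simp add: unital_star_hom_on_def class_alg_def)

text \<open>
  Multiplicativity turns the antipode laws of \<open>H\<close> into the statement that \<open>U\<close> and \<open>U\<close> after the
  antipode are inverse for convolution; this is what makes the tensor belonging to \<open>U\<close> unitary.
\<close>

lemma conv_antipode:
  assumes U: "star_rep U"
  shows "conv (\<lambda>x. U (antipode H x)) U h = counit H h *\<^sub>C 1"
    "conv U (\<lambda>x. U (antipode H x)) h = counit H h *\<^sub>C 1"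
proof -
  note U_simps = star_rep_simps[OF U]
  have "U (tlift (\<lambda>x y. mult H (antipode H x) y) (comult H h)) =
      tlift (\<lambda>x y. U (mult H (antipode H x) y)) (comult H h)"
    by (rule clinear_apply_tlift) (auto intro!: linear_intros U_simps)
  then show "conv (\<lambda>x. U (antipode H x)) U h = counit H h *\<^sub>C 1"
    by (simp add: conv_def antipode_laws U_simps clinear_simps[OF U_simps(1)])
  have "U (tlift (\<lambda>x y. mult H x (antipode H y)) (comult H h)) =
      tlift (\<lambda>x y. U (mult H x (antipode H y))) (comult H h)"
    by (rule clinear_apply_tlift) (auto intro!: linear_intros U_simps)
  then show "conv U (\<lambda>x. U (antipode H x)) h = counit H h *\<^sub>C 1"
    by (simp add: conv_def antipode_laws U_simps clinear_simps[OF U_simps(1)])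
qed

lemma star_rep_counit: "star_rep (\<lambda>h. counit H h *\<^sub>C (1 :: 'c::star_algebra))"
proof (rule star_repI)
  have "adj (1 :: 'c) = 1"
    by (metis adj_adj adj_mult mult.right_neutral)
  then show "counit H (star H x) *\<^sub>C 1 = adj (counit H x *\<^sub>C 1 :: 'c)" for x
    by (simp add: counit_hom adj_scaleC)
qed (auto intro!: linear_intros simp: counit_hom mult_scaleC_left mult_scaleC_right mult.commute)

text \<open>
  The comultiplication is a *-homomorphism, and commuting ranges make $a \otimes b \mapsto U(a) V(b)$
  one as well; the convolution product is their composition.
\<close>

lemma star_rep_conv:
  assumes U: "star_rep U" and V: "star_rep V" and comm: "\<And>x y. U x * V y = V y * U x"
  shows "star_rep (conv U V)"
proof (rule star_repI)
  note U_simps = star_rep_simps[OF U] and V_simps = star_rep_simps[OF V]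
  note intros = linear_intros U_simps(1) V_simps(1) clinear_compose[OF U_simps(1)] clinear_compose[OF V_simps(1)]
  have bil: "cbilinear (\<lambda>x y. U x * V y)"
    unfolding cbilinear_def by (auto intro!: intros)
  show "clinear (conv U V)" by (rule clinear_conv[OF U_simps(1) V_simps(1)])
  show "conv U V (unit H) = 1"
    unfolding conv_def comult_hom by (subst tlift_tensor) (auto intro!: intros simp: U_simps V_simps)
  have exchange: "U (mult H a a') * V (mult H b b') = (U a * V b) * (U a' * V b')" for a a' b b'
  proof -
    have "U (mult H a a') * V (mult H b b') = U a * (U a' * V b) * V b'"
      by (simp add: U_simps V_simps mult.assoc)
    also have "\<dots> = U a * (V b * U a') * V b'" by (simp only: comm)
    finally show ?thesis by (simp add: mult.assoc)
  qed
  fix h k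
  have "conv U V (mult H h k) =
      tlift (\<lambda>a b. tlift (\<lambda>a' b'. (U a * V b) * (U a' * V b')) (comult H k)) (comult H h)"
    unfolding conv_def comult_hom
    by (simp only: tlift_tensor_alg_mult[OF cbilinear_H cbilinear_H bil] exchange)
  also have "\<dots> = tlift (\<lambda>a b. (U a * V b) * conv U V k) (comult H h)"
    unfolding conv_def
    by (subst clinear_apply_tlift[where g = "\<lambda>z. _ * z"]) (auto intro!: intros)
  also have "\<dots> = conv U V h * conv U V k"
    unfolding conv_def[of _ _ h]
    by (subst clinear_apply_tlift[where g = "\<lambda>z. z * _"]) (auto intro!: intros)
  finally show "conv U V (mult H h k) = conv U V h * conv U V k" .
  have "tlift (\<lambda>x y. U x * V y) (star (tensor_alg H H) t) = adj (tlift (\<lambda>x y. U x * V y) t)" for t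
  proof (induction t rule: tensor_induct)
    case (elem a b)
    have "adj (U a) * adj (V b) = adj (V b) * adj (U a)"
      by (metis adj_mult comm)
    then show ?case
      by (simp add: tensor_alg_star_tensor[OF conj_linear_star_H conj_linear_star_H] tlift_tensor intros
          U_simps V_simps adj_mult)
  next
    case (add s t)
    have lin: "clinear (tlift (\<lambda>x y. U x * V y))" by (auto intro!: intros)
    show ?case
      using add tensor_alg_star_tensor(2)[OF conj_linear_star_H conj_linear_star_H]
      by (simp add: conj_linear_def clinear_simps[OF lin] adj_add)
  qed
  then show "conv U V (star H h) = adj (conv U V h)"
    by (simp add: conv_def comult_hom)
qed

end

section \<open>Sequences modulo null sequences\<close>

lemma linf_cases:
  obtains d where "Bseq d" "x = seq_class d"
  by (metis Quotient3_abs_rep[OF Quotient3_linf] Quotient3_rep_reflp[OF Quotient3_linf])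

lemma seq_class_eq_iff:
  assumes "Bseq x" "Bseq y"
  shows "seq_class x = seq_class y \<longleftrightarrow> (\<lambda>n. x n - y n) \<longlonglongrightarrow> 0"
  using Quotient3_rel[OF Quotient3_linf, of x y] assms by simp

lemma seq_class_simps:
  "1 = seq_class (\<lambda>_. 1)"
  "Bseq x \<Longrightarrow> Bseq y \<Longrightarrow> seq_class x + seq_class y = seq_class (\<lambda>n. x n + y n)"
  "Bseq x \<Longrightarrow> Bseq y \<Longrightarrow> seq_class x * seq_class y = seq_class (\<lambda>n. x n * y n)"
  "Bseq x \<Longrightarrow> adj (seq_class x) = seq_class (\<lambda>n. adj (x n))"
  "Bseq x \<Longrightarrow> c *\<^sub>C seq_class x = seq_class (\<lambda>n. c *\<^sub>C x n)"
  by (simp_all add: one_linf.abs_eq plus_linf.abs_eq times_linf.abs_eq adj_linf.abs_eq scaleC_linf.abs_eq)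

lemma clinear_const_linf: "clinear const_linf"
  by (simp add: clinear_iff const_linf_def seq_class_simps)

text \<open>Continuity of a linear map at the origin bounds it on a ball, hence on every ball.\<close>

lemma clinear_continuous_bounded:
  fixes f :: "'a::cstar_algebra \<Rightarrow> 'b::cstar_algebra"
  assumes lin: "clinear f" and cont: "continuous_on UNIV f"
  obtains C where "C > 0" "\<And>x. norm (f x) \<le> C * norm x"
proof -
  have "isCont f 0"
    using cont by (simp add: continuous_on_eq_continuous_at)
  then obtain \<delta> where \<delta>: "\<delta> > 0" "\<And>x. norm x < \<delta> \<Longrightarrow> norm (f x) < 1"
    unfolding continuous_at_eps_delta
    by (metis clinear_simps(3)[OF lin] dist_0_norm dist_commute zero_less_one)
  have "norm (f x) \<le> 2 / \<delta> * norm x" for x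
  proof (cases "x = 0")
    case False
    define c where "c = \<delta> / (2 * norm x)"
    have c: "c > 0" "c * norm x < \<delta>" using False \<delta> by (simp_all add: c_def)
    have "norm (f (complex_of_real c *\<^sub>C x)) < 1"
      using c by (intro \<delta>(2)) (simp add: norm_scaleC)
    then have "c * norm (f x) < 1"
      using c by (simp add: clinear_simps[OF lin] norm_scaleC)
    then show ?thesis using False \<delta>(1) by (simp add: c_def field_simps)
  qed (simp add: clinear_simps[OF lin])
  with \<delta>(1) that[of "2 / \<delta>"] show ?thesis by simp
qed

lemma Bseq_bounded_image:
  fixes f :: "'a::cstar_algebra \<Rightarrow> 'b::cstar_algebra"
  assumes "clinear f" "continuous_on UNIV f" "Bseq d"
  shows "Bseq (\<lambda>n. f (d n))"
proof -
  obtain C where C: "C > 0" "\<And>x. norm (f x) \<le> C * norm x"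
    using clinear_continuous_bounded[OF assms(1,2)] by blast
  obtain K where "\<And>n. norm (d n) \<le> K" using assms(3) by (auto simp: Bseq_def)
  then have "norm (f (d n)) \<le> C * K" for n
    using C by (meson mult_left_mono order_trans less_imp_le)
  then show ?thesis by (rule BseqI')
qed

subsection \<open>Uniform boundedness of representations\<close>

text \<open>A constant factor is negligible against the growth of powers with unbounded exponent.\<close>

lemma power_growth_le:
  fixes a b C :: real
  assumes "0 \<le> a" "0 \<le> b" and pow: "\<And>k. a ^ 2 ^ k \<le> C * b ^ 2 ^ k"
  shows "a \<le> b"
proof (rule ccontr)
  assume "\<not> a \<le> b"
  show False
  proof (cases "b = 0")
    case True
    then show False using pow[of 0] \<open>\<not> a \<le> b\<close> by simp
  next
    case False
    then have "a / b > 1" using \<open>\<not> a \<le> b\<close> assms by simp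
    then obtain k where "C < (a / b) ^ k" using real_arch_pow by blast
    also have "\<dots> \<le> (a / b) ^ 2 ^ k"
      using \<open>a / b > 1\<close> by (intro power_increasing) (simp_all add: less_imp_le)
    also have "\<dots> \<le> C"
      using pow[of k] False assms by (simp add: power_divide divide_le_eq)
    finally show False by simp
  qed
qed

context hopf_coordinates
begin

text \<open>
  The spectral radius argument: for selfadjoint \<open>y\<close> the C*-identity gives
  $\|U(y)\|^{2^k} = \|U(y^{2^k})\|$, and the right hand side is at most a constant depending on \<open>U\<close>
  times the size of $y^{2^k}$ in a fixed submultiplicative seminorm on \<open>H\<close>. Taking roots removes
  the constant, so that the bound no longer depends on \<open>U\<close>. A general \<open>h\<close> is handled through
  $h^* h$. The seminorm is a multiple of the sum of the absolute values of the coordinates.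
\<close>

lemma star_rep_uniformly_bounded:
  "\<exists>K. \<forall>U :: 'h \<Rightarrow> 'c::cstar_algebra. star_rep U \<longrightarrow> norm (U h) \<le> K"
proof -
  define N where "N x = (\<Sum>b\<in>B. cmod (app (e b) x))" for x
  \<comment> \<open>\<open>M\<close> absorbs the structure constants, so that \<open>M * N\<close> is submultiplicative; the summand \<open>1\<close>
    makes \<open>M * N\<close> dominate \<open>N\<close>.\<close>
  define M where "M = 1 + (\<Sum>b\<in>B. \<Sum>c\<in>B. N (mult H b c))"
  have N_nonneg: "N x \<ge> 0" for x by (simp add: N_def sum_nonneg)
  have M: "M \<ge> 1" by (simp add: M_def sum_nonneg N_nonneg)
  have N_add: "N (x + y) \<le> N x + N y" for x y
    unfolding N_def by (simp add: clinear_simps[OF clinear_app] norm_triangle_ineq sum_mono flip: sum.distrib)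
  have N_scale: "N (c *\<^sub>C x) = cmod c * N x" for c x
    unfolding N_def by (simp add: clinear_simps[OF clinear_app] norm_mult sum_distrib_left)
  have N_sum: "N (\<Sum>i\<in>I. f i) \<le> (\<Sum>i\<in>I. N (f i))" for I :: "'h set" and f
  proof (induction I rule: infinite_finite_induct)
    case (insert x F)
    then show ?case using N_add[of "f x" "\<Sum>i\<in>F. f i"] by simp
  qed (simp_all add: N_def clinear_simps[OF clinear_app])
  have coord: "cmod (app (e b) x) \<le> N x" if "b \<in> B" for b x
    unfolding N_def using that finite_B by (intro member_le_sum) auto
  have N_mult: "N (mult H x y) \<le> M * N x * N y" for x y
  proof -
    have "mult H x y = mult H (\<Sum>b\<in>B. app (e b) x *\<^sub>C b) (\<Sum>c\<in>B. app (e c) y *\<^sub>C c)"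
      by (simp only: expansion)
    also have "\<dots> = (\<Sum>b\<in>B. mult H (app (e b) x *\<^sub>C b) (\<Sum>c\<in>B. app (e c) y *\<^sub>C c))"
      by (rule clinear_sum) (auto intro!: linear_intros)
    also have "\<dots> = (\<Sum>b\<in>B. \<Sum>c\<in>B. mult H (app (e b) x *\<^sub>C b) (app (e c) y *\<^sub>C c))"
      by (intro sum.cong refl clinear_sum) (auto intro!: linear_intros)
    also have "\<dots> = (\<Sum>b\<in>B. \<Sum>c\<in>B. app (e b) x *\<^sub>C app (e c) y *\<^sub>C mult H b c)"
      by (simp only: clinear_simps[OF cbilinear_H[THEN cbilinear_clinear(2), OF clinear_basic(1)]]
          clinear_simps[OF cbilinear_H[THEN cbilinear_clinear(1), OF clinear_basic(1)]])
        (rule sum.cong[OF refl sum.cong[OF refl complex_vector.scale_left_commute]])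
    finally have "N (mult H x y) \<le> (\<Sum>b\<in>B. N (\<Sum>c\<in>B. app (e b) x *\<^sub>C app (e c) y *\<^sub>C mult H b c))"
      by (simp only: N_sum)
    also have "\<dots> \<le> (\<Sum>b\<in>B. \<Sum>c\<in>B. N (app (e b) x *\<^sub>C app (e c) y *\<^sub>C mult H b c))"
      by (intro sum_mono N_sum)
    also have "\<dots> \<le> (\<Sum>b\<in>B. \<Sum>c\<in>B. N x * N y * N (mult H b c))"
      unfolding N_scale mult.assoc[symmetric]
      by (intro sum_mono mult_mono coord N_nonneg mult_nonneg_nonneg) auto
    also have "\<dots> = N x * N y * (M - 1)"
      by (simp add: M_def sum_distrib_left)
    also have "\<dots> \<le> M * N x * N y"
      using N_nonneg[of x] N_nonneg[of y] by (simp add: algebra_simps)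
    finally show ?thesis .
  qed
  have selfadjoint: "norm (U y) \<le> M * N y" if U: "star_rep U" and y: "star H y = y"
    for U :: "'h \<Rightarrow> 'c" and y
  proof -
    \<comment> \<open>\<open>p k\<close> is $y^{2^k}$, by repeated squaring\<close>
    define p where "p k = ((\<lambda>z. mult H z z) ^^ k) y" for k
    have p_Suc: "p (Suc k) = mult H (p k) (p k)" for k by (simp add: p_def)
    have p_star: "star H (p k) = p k" for k
      by (induction k) (simp_all add: p_Suc star_H_simps, simp add: p_def y)
    have norm_p: "norm (U (p k)) = norm (U y) ^ 2 ^ k" for k
    proof (induction k)
      case (Suc k)
      have "norm (U (p (Suc k))) = norm (adj (U (p k)) * U (p k))"
        by (simp add: p_Suc p_star star_rep_simps(3)[OF U] flip: star_rep_simps(4)[OF U])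
      then show ?case
        by (simp add: cstar_identity Suc power_mult[symmetric] mult.commute)
    qed (simp add: p_def)
    have N_p: "M * N (p k) \<le> (M * N y) ^ 2 ^ k" for k
    proof (induction k)
      case (Suc k)
      have "M * N (p (Suc k)) \<le> M * (M * N (p k) * N (p k))"
        unfolding p_Suc using M by (intro mult_left_mono N_mult) auto
      also have "\<dots> = (M * N (p k))\<^sup>2" by (simp add: power2_eq_square)
      also have "\<dots> \<le> ((M * N y) ^ 2 ^ k)\<^sup>2"
        using Suc M N_nonneg by (intro power_mono) auto
      finally show ?case by (simp only: power_Suc mult.commute[of 2 "2 ^ k"] power_mult)
    qed (simp add: p_def)
    define C where "C = (\<Sum>b\<in>B. norm (U b))"
    have U_le: "norm (U x) \<le> C * N x" for x
    proof -
      have "norm (U x) = norm (\<Sum>b\<in>B. app (e b) x *\<^sub>C U b)"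
        using clinear_sum[OF star_rep_simps(1)[OF U], of "\<lambda>b. app (e b) x *\<^sub>C b" B]
        by (simp only: expansion clinear_simps[OF star_rep_simps(1)[OF U]])
      also have "\<dots> \<le> (\<Sum>b\<in>B. N x * norm (U b))"
        by (intro sum_norm_le) (simp add: norm_scaleC coord mult_right_mono)
      finally show ?thesis by (simp only: C_def mult.commute[of _ "N x"] sum_distrib_left)
    qed
    have C: "C \<ge> 0" by (simp add: C_def sum_nonneg)
    have "norm (U y) ^ 2 ^ k \<le> C * (M * N y) ^ 2 ^ k" for k
    proof -
      have "norm (U y) ^ 2 ^ k \<le> C * N (p k)"
        using U_le[of "p k"] by (simp only: norm_p)
      moreover have "N (p k) \<le> (M * N y) ^ 2 ^ k"
        using mult_right_mono[OF M N_nonneg[of "p k"]] N_p[of k] by linarith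
      then have "C * N (p k) \<le> C * (M * N y) ^ 2 ^ k"
        by (rule mult_left_mono[OF _ C])
      ultimately show ?thesis by (rule order_trans)
    qed
    moreover have "0 \<le> M * N y"
      using M N_nonneg[of y] by (intro mult_nonneg_nonneg) simp_all
    ultimately show ?thesis
      by (intro power_growth_le[OF norm_ge_zero])
  qed
  have "norm (U h) \<le> sqrt (M * N (mult H (star H h) h))" if U: "star_rep U" for U :: "'h \<Rightarrow> 'c"
  proof (rule real_le_rsqrt)
    have "(norm (U h))\<^sup>2 = norm (U (mult H (star H h) h))"
      by (simp add: cstar_identity star_rep_simps[OF U])
    also have "\<dots> \<le> M * N (mult H (star H h) h)"
      by (rule selfadjoint[OF U]) (simp add: star_H_simps)
    finally show "(norm (U h))\<^sup>2 \<le> M * N (mult H (star H h) h)" .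
  qed
  then show ?thesis by blast
qed

lemma star_rep_Bseq:
  fixes U :: "nat \<Rightarrow> 'h \<Rightarrow> 'c::cstar_algebra"
  assumes "\<And>n. star_rep (U n)"
  shows "Bseq (\<lambda>n. U n h)"
proof -
  obtain K where "\<And>U :: 'h \<Rightarrow> 'c. star_rep U \<Longrightarrow> norm (U h) \<le> K"
    using star_rep_uniformly_bounded by blast
  then show ?thesis using assms by (intro BseqI'[of _ K]) auto
qed

text \<open>
  Convolution involves only finitely many products, so it can be computed componentwise on bounded
  sequences. The two claims are proved together because the first needs boundedness of the summands.
\<close>

lemma conv_seq_class:
  assumes p: "\<And>n. clinear (p n)" "\<And>x. Bseq (\<lambda>n. p n x)"
    and q: "\<And>n. clinear (q n)" "\<And>x. Bseq (\<lambda>n. q n x)"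
  shows "conv (\<lambda>x. seq_class (\<lambda>n. p n x)) (\<lambda>x. seq_class (\<lambda>n. q n x)) h =
      seq_class (\<lambda>n. conv (p n) (q n) h)"
    and "Bseq (\<lambda>n. conv (p n) (q n) h)"
proof -
  note simps = clinear_simps[OF p(1)] clinear_simps[OF q(1)]
  have lin: "clinear (\<lambda>x. seq_class (\<lambda>n. p n x))" "clinear (\<lambda>x. seq_class (\<lambda>n. q n x))"
    using p q by (simp_all add: clinear_iff simps seq_class_simps)
  have "tlift (\<lambda>x y. seq_class (\<lambda>n. p n x) * seq_class (\<lambda>n. q n y)) t =
      seq_class (\<lambda>n. tlift (\<lambda>x y. p n x * q n y) t) \<and> Bseq (\<lambda>n. tlift (\<lambda>x y. p n x * q n y) t)" for t
  proof (induction t rule: tensor_induct)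
    case (elem a b)
    have "tlift (\<lambda>x y. seq_class (\<lambda>n. p n x) * seq_class (\<lambda>n. q n y)) (a \<otimes>\<^sub>t b) =
        seq_class (\<lambda>n. p n a) * seq_class (\<lambda>n. q n b)"
      by (rule tlift_tensor) (auto intro!: linear_intros lin)
    then show ?case
      by (simp add: tlift_tensor linear_intros p q seq_class_simps Bseq_mult_same)
  next
    case (add s t)
    have "clinear (tlift (\<lambda>x y. p n x * q n y))" for n
      by (auto intro!: linear_intros p q)
    note lin1 = clinear_simps[OF this]
    have "clinear (tlift (\<lambda>x y. seq_class (\<lambda>n. p n x) * seq_class (\<lambda>n. q n y)))"
      by (auto intro!: linear_intros lin)
    note lin2 = clinear_simps[OF this]
    from add show ?case
      by (simp add: lin1 lin2 seq_class_simps Bseq_add_same)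
  qed
  then show "conv (\<lambda>x. seq_class (\<lambda>n. p n x)) (\<lambda>x. seq_class (\<lambda>n. q n x)) h =
      seq_class (\<lambda>n. conv (p n) (q n) h)" "Bseq (\<lambda>n. conv (p n) (q n) h)"
    by (simp_all add: conv_def)
qed

subsection \<open>The extension of a coaction to sequences\<close>

text \<open>Slicing is componentwise, so the tensor represented by a sequence is unique.\<close>

lemma hat_represents:
  fixes X :: "nat \<Rightarrow> ('d::cstar_algebra, 'h dual) tensor"
  assumes "represents X t"
  shows "hat t h = seq_class (\<lambda>n. hat (X n) h)"
proof -
  obtain m :: nat and d k where d: "\<And>i. i < m \<Longrightarrow> Bseq (d i)"
    and X: "\<And>n. X n = (\<Sum>i<m. d i n \<otimes>\<^sub>t k i)" and t: "t = (\<Sum>i<m. seq_class (d i) \<otimes>\<^sub>t k i)"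
    using assms by (auto simp: represents_def)
  have hat_sum: "hat (\<Sum>i\<in>I. s i) h = (\<Sum>i\<in>I. hat (s i) h)" for I and s :: "nat \<Rightarrow> ('x::complex_vector, 'h dual) tensor"
    by (rule clinear_sum[OF clinear_hat(1)[OF clinear_basic(1)]])
  have "(\<Sum>i<j. app (k i) h *\<^sub>C seq_class (d i)) = seq_class (\<lambda>n. \<Sum>i<j. app (k i) h *\<^sub>C d i n) \<and>
      Bseq (\<lambda>n. \<Sum>i<j. app (k i) h *\<^sub>C d i n)" if "j \<le> m" for j
    using that
  proof (induction j)
    case 0
    then show ?case by (simp add: zero_linf.abs_eq)
  next
    case (Suc j)
    then show ?case by (simp add: seq_class_simps d Bseq_scaleC Bseq_add_same)
  qed
  then show ?thesis
    unfolding X t hat_sum hat_tensor by blast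
qed

text \<open>
  Continuity of the slices of \<open>\<beta>\<close> at the origin makes the values independent of the representing
  sequence, and their boundedness makes the coordinates of \<open>\<beta> (d n)\<close> bounded sequences, from which
  the represented tensor is assembled.
\<close>

lemma coaction_infty_hat:
  fixes \<beta> :: "'d::cstar_algebra \<Rightarrow> ('d, 'h dual) tensor"
  assumes lin: "clinear \<beta>" and cont: "\<And>h. continuous_on UNIV (\<lambda>b. hat (\<beta> b) h)" and d: "Bseq d"
  shows "hat (coaction_infty \<beta> (seq_class d)) h = seq_class (\<lambda>n. hat (\<beta> (d n)) h)"
proof -
  let ?P = "\<lambda>t. \<exists>d'. Bseq d' \<and> seq_class d = seq_class d' \<and> represents (\<lambda>n. \<beta> (d' n)) t"
  have lin_hat: "clinear (\<lambda>b. hat (\<beta> b) h)" for h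
    by (rule clinear_compose[OF _ lin, of "\<lambda>t. hat t h"]) (auto intro!: linear_intros)
  have bounded: "Bseq (\<lambda>n. hat (\<beta> (d n)) h)" if "Bseq d" for d h
    by (rule Bseq_bounded_image[OF lin_hat cont that])
  have hat_P: "hat t h = seq_class (\<lambda>n. hat (\<beta> (d n)) h)" if P: "?P t" for t h
  proof -
    obtain d' where d': "Bseq d'" "seq_class d = seq_class d'" "represents (\<lambda>n. \<beta> (d' n)) t"
      using P by blast
    have "(\<lambda>n. d n - d' n) \<longlonglongrightarrow> 0"
      using d' d seq_class_eq_iff by blast
    moreover have "isCont (\<lambda>b. hat (\<beta> b) h) 0"
      using cont by (simp add: continuous_on_eq_continuous_at)
    ultimately have "(\<lambda>n. hat (\<beta> (d n - d' n)) h) \<longlonglongrightarrow> hat (\<beta> 0) h"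
      using isCont_tendsto_compose by blast
    then have "(\<lambda>n. hat (\<beta> (d n)) h - hat (\<beta> (d' n)) h) \<longlonglongrightarrow> 0"
      by (simp add: clinear_simps[OF lin_hat])
    then have "seq_class (\<lambda>n. hat (\<beta> (d n)) h) = seq_class (\<lambda>n. hat (\<beta> (d' n)) h)"
      by (simp add: seq_class_eq_iff bounded d d'(1))
    then show ?thesis
      by (simp add: hat_represents[OF d'(3)])
  qed
  \<comment> \<open>representing families are indexed by an initial segment of the naturals\<close>
  obtain f :: "nat \<Rightarrow> 'h" where f: "bij_betw f {..<card B} B"
    using ex_bij_betw_nat_finite[OF finite_B] by (auto simp: atLeast0LessThan)
  define t where "t = (\<Sum>i<card B. seq_class (\<lambda>n. hat (\<beta> (d n)) (f i)) \<otimes>\<^sub>t e (f i))"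
  have "\<beta> (d n) = (\<Sum>i<card B. hat (\<beta> (d n)) (f i) \<otimes>\<^sub>t e (f i))" for n
    using tensor_expansion[of "\<beta> (d n)"] sum.reindex_bij_betw[OF f, of "\<lambda>b. hat (\<beta> (d n)) b \<otimes>\<^sub>t e b"] by simp
  then have "represents (\<lambda>n. \<beta> (d n)) t"
    unfolding represents_def t_def
    by (intro exI[of _ "card B"] exI[of _ "\<lambda>i n. hat (\<beta> (d n)) (f i)"] exI[of _ "\<lambda>i. e (f i)"])
      (simp add: bounded d)
  then have "?P t" using d by blast
  moreover have "s = s'" if "?P s" "?P s'" for s s'
    by (rule hat_eqI) (simp only: hat_P[OF that(1)] hat_P[OF that(2)])
  ultimately have "\<exists>!t. ?P t" by blast
  then have "?P (THE t. ?P t)" by (rule theI')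
  then show ?thesis
    unfolding coaction_infty_def by (rule hat_P)
qed

text \<open>Linearity is what allows the extended coaction to be applied to one factor of a tensor.\<close>

lemma clinear_coaction_infty:
  fixes \<beta> :: "'d::cstar_algebra \<Rightarrow> ('d, 'h dual) tensor"
  assumes lin: "clinear \<beta>" and cont: "\<And>h. continuous_on UNIV (\<lambda>b. hat (\<beta> b) h)"
  shows "clinear (coaction_infty \<beta>)"
proof -
  note hat_simp = coaction_infty_hat[OF assms]
  have lin_hat: "clinear (\<lambda>b. hat (\<beta> b) h)" for h
    by (rule clinear_compose[OF _ lin, of "\<lambda>t. hat t h"]) (auto intro!: linear_intros)
  note simps = clinear_simps[OF lin_hat] clinear_simps[OF clinear_hat(1)[OF clinear_basic(1)]]
    Bseq_bounded_image[OF lin_hat cont]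
  show ?thesis
    unfolding clinear_iff
  proof (intro conjI allI hat_eqI)
    fix x y :: "'d linf" and c h
    obtain d d' where d: "Bseq d" "x = seq_class d" and d': "Bseq d'" "y = seq_class d'"
      by (metis linf_cases)
    show "hat (coaction_infty \<beta> (x + y)) h = hat (coaction_infty \<beta> x + coaction_infty \<beta> y) h"
      by (simp add: d d' seq_class_simps hat_simp Bseq_add_same simps)
    show "hat (coaction_infty \<beta> (c *\<^sub>C x)) h = hat (c *\<^sub>C coaction_infty \<beta> x) h"
      by (simp add: d seq_class_simps hat_simp Bseq_scaleC simps)
  qed
qed

end

section \<open>Approximate representability from asymptotically inner representations\<close>

context hopf_coordinates
begin

lemma hat_class_mult:
  "hat (mult (tensor_alg class_alg (dual_hopf H)) s t) h = conv (hat s) (hat t) h"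
  by (simp add: hat_mult cbilinear_class_alg conv_def) (simp add: class_alg_def)

lemma hat_class_star:
  "hat (star (tensor_alg class_alg (dual_hopf H)) t) h = adj (hat t (star H (antipode H h)))"
  by (simp add: hat_star conj_linear_adj) (simp add: class_alg_def)

text \<open>
  The unitary is the tensor whose linear map is the representation \<open>W\<close> of \<open>H\<close> on sequences with
  components \<open>U n\<close>. Unitarity is the antipode law and the implementation of \<open>\<beta>\<close> is \<open>inner\<close>. The
  condition $w_{12} w_{13} = (\mathrm{id} \otimes \Delta)(w)$ is multiplicativity of \<open>W\<close>. In the
  condition on the extended coaction, \<open>action\<close> gives $W(x_{(1)}) W(y) W(S(x_{(2)})) W(x_{(3)})$ for
  the left hand side, which the antipode law reduces to $W(x) W(y)$.
\<close>

proposition approximately_representable_criterion: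
  fixes \<beta> :: "'b::cstar_algebra \<Rightarrow> ('b, 'h dual) tensor" and U :: "nat \<Rightarrow> 'h \<Rightarrow> 'b"
  assumes lin: "clinear \<beta>"
    and cont: "\<And>h. continuous_on UNIV (\<lambda>b. hat (\<beta> b) h)"
    and U: "\<And>n. star_rep (U n)"
    and inner: "\<And>d h. (\<lambda>n. hat (\<beta> d) h - conv (\<lambda>x. U n x * d) (\<lambda>x. U n (antipode H x)) h) \<longlonglongrightarrow> 0"
    and action: "\<And>n y h. hat (\<beta> (U n y)) h = conv (\<lambda>x. U n x * U n y) (\<lambda>x. U n (antipode H x)) h"
  shows "approximately_representable (dual_hopf H) \<beta>"
proof -
  define W where "W h = seq_class (\<lambda>n. U n h)" for h
  note U_simps = star_rep_simps[OF U] and bounded = star_rep_Bseq[of U, OF U]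
  have W: "star_rep W"
    by (rule star_repI)
      (simp_all add: W_def clinear_iff U_simps clinear_simps[OF U_simps(1)] seq_class_simps bounded)
  note W_simps = star_rep_simps[OF W]
  have W_antipode: "clinear (\<lambda>x. W (antipode H x))"
    by (rule clinear_compose[OF W_simps(1)]) (auto intro!: linear_intros)
  define w where "w = (\<Sum>b\<in>B. W b \<otimes>\<^sub>t e b)"
  have hat_w: "hat w = W"
    by (rule ext) (simp add: w_def hat_of_map W_simps)
  define T :: "('b linf, 'h dual) tensor star_alg" where "T = tensor_alg class_alg (dual_hopf H)"
  have T_bilinear: "cbilinear (mult T)"
    unfolding T_def by (rule cbilinear_tensor_alg[OF cbilinear_class_alg cbilinear_dual])
  note T_simps = clinear_simps[OF T_bilinear[THEN cbilinear_clinear(1), OF clinear_basic(1)]]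
    clinear_simps[OF T_bilinear[THEN cbilinear_clinear(2), OF clinear_basic(1)]]
  have hat_T: "hat (mult T s t) = conv (hat s) (hat t)" for s t
    unfolding T_def by (rule ext) (rule hat_class_mult)
  have hat_unit: "hat (d \<otimes>\<^sub>t unit (dual_hopf H)) = (\<lambda>h. counit H h *\<^sub>C d)" for d :: "'c::complex_vector"
    by (rule ext) (rule hat_tensor_unit)
  have hat_w_star: "hat (star T w) = (\<lambda>h. W (antipode H h))"
    unfolding T_def hat_class_star hat_w by (rule ext) (simp add: W_simps adj_adj)
  have unit_T: "unit T = 1 \<otimes>\<^sub>t unit (dual_hopf H)"
    by (simp add: T_def tensor_alg_def class_alg_def)
  have conv_scalar: "conv p (\<lambda>x. counit H x *\<^sub>C c) = (\<lambda>h. p h * c)" if "clinear p" for p :: "'h \<Rightarrow> 'b linf" and c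
    by (rule ext) (rule conv_counit(2)[OF that])
  have unitary: "unitary_in T w"
    unfolding unitary_in_def unit_T
    by (intro conjI hat_eqI) (simp_all add: hat_T hat_w hat_w_star hat_unit conv_antipode[OF W])
  have implements: "tmap const_linf id (\<beta> d) = mult T (mult T w (const_linf d \<otimes>\<^sub>t unit (dual_hopf H))) (star T w)" for d
  proof (rule hat_eqI)
    fix h
    have lins: "clinear (\<lambda>x. U n x * d)" "clinear (\<lambda>x. U n (antipode H x))" for n
      by (auto intro!: linear_intros U_simps clinear_compose[OF U_simps(1)])
    have bnd: "Bseq (\<lambda>n. U n x * d)" for x
      using bounded by (intro Bseq_mult_same) auto
    have "hat (mult T (mult T w (const_linf d \<otimes>\<^sub>t unit (dual_hopf H))) (star T w)) h =
        conv (\<lambda>x. W x * const_linf d) (\<lambda>x. W (antipode H x)) h"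
      by (simp add: hat_T hat_w hat_w_star hat_unit conv_scalar W_simps)
    also have "(\<lambda>x. W x * const_linf d) = (\<lambda>x. seq_class (\<lambda>n. U n x * d))"
      by (simp add: W_def const_linf_def seq_class_simps bounded)
    also have "conv \<dots> (\<lambda>x. W (antipode H x)) h =
        seq_class (\<lambda>n. conv (\<lambda>x. U n x * d) (\<lambda>x. U n (antipode H x)) h)"
      unfolding W_def by (rule conv_seq_class(1)) (simp_all add: lins bnd bounded)
    also have "\<dots> = const_linf (hat (\<beta> d) h)"
      unfolding const_linf_def using inner[of d h] lins bnd bounded
      by (subst eq_commute, subst seq_class_eq_iff) (auto intro!: conv_seq_class(2))
    finally show "hat (tmap const_linf id (\<beta> d)) h =
        hat (mult T (mult T w (const_linf d \<otimes>\<^sub>t unit (dual_hopf H))) (star T w)) h"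
      by (simp add: hat_tmap clinear_const_linf)
  qed
  define T2 where "T2 = tensor_alg T (dual_hopf H)"
  have hat_T2: "hat (mult T2 s t) y = tlift (\<lambda>y y'. mult T (hat s y) (hat t y')) (comult H y)" for s t y
    unfolding T2_def by (rule hat_mult[OF T_bilinear])
  have corepresentation: "assoc (mult T2 (w \<otimes>\<^sub>t unit (dual_hopf H)) (tmap (\<lambda>d. d \<otimes>\<^sub>t unit (dual_hopf H)) id w)) =
      tmap id (comult (dual_hopf H)) w"
  proof (rule hat2_eqI)
    fix x y
    have lin_unit: "clinear (\<lambda>d. (d :: 'b linf) \<otimes>\<^sub>t unit (dual_hopf H))"
      by (auto intro!: linear_intros)
    have "hat (mult T2 (w \<otimes>\<^sub>t unit (dual_hopf H)) (tmap (\<lambda>d. d \<otimes>\<^sub>t unit (dual_hopf H)) id w)) y =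
        tlift (\<lambda>y y'. counit H y *\<^sub>C mult T w (W y' \<otimes>\<^sub>t unit (dual_hopf H))) (comult H y)"
      unfolding hat_T2 by (simp add: hat_unit hat_tmap[OF lin_unit] hat_w T_simps)
    also have "\<dots> = mult T w (W y \<otimes>\<^sub>t unit (dual_hopf H))"
      by (rule tlift_counit(1))
        (auto intro!: linear_intros W_simps T_bilinear[THEN cbilinear_clinear(1)])
    finally show "hat2 (assoc (mult T2 (w \<otimes>\<^sub>t unit (dual_hopf H)) (tmap (\<lambda>d. d \<otimes>\<^sub>t unit (dual_hopf H)) id w))) x y =
        hat2 (tmap id (comult (dual_hopf H)) w) x y"
      by (simp add: hat2_assoc hat2_comult hat_T hat_unit hat_w conv_scalar W_simps)
  qed
  have action_infty: "hat (coaction_infty \<beta> (W y)) = conv (\<lambda>x. W x * W y) (\<lambda>x. W (antipode H x))" for y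
  proof
    fix h
    have lins: "clinear (\<lambda>x. U n x * U n y)" "clinear (\<lambda>x. U n (antipode H x))" for n
      by (auto intro!: linear_intros U_simps clinear_compose[OF U_simps(1)])
    have bnd: "Bseq (\<lambda>n. U n x * U n y)" for x
      using bounded by (intro Bseq_mult_same) auto
    have "hat (coaction_infty \<beta> (W y)) h = seq_class (\<lambda>n. conv (\<lambda>x. U n x * U n y) (\<lambda>x. U n (antipode H x)) h)"
      unfolding W_def by (simp add: coaction_infty_hat[OF lin cont] bounded action)
    also have "\<dots> = conv (\<lambda>x. seq_class (\<lambda>n. U n x * U n y)) (\<lambda>x. seq_class (\<lambda>n. U n (antipode H x))) h"
      by (rule conv_seq_class(1)[symmetric]) (simp_all add: lins bnd bounded)
    also have "\<dots> = conv (\<lambda>x. W x * W y) (\<lambda>x. W (antipode H x)) h"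
      by (simp add: W_def seq_class_simps bounded)
    finally show "hat (coaction_infty \<beta> (W y)) h = conv (\<lambda>x. W x * W y) (\<lambda>x. W (antipode H x)) h" .
  qed
  have covariance: "assoc (mult T2 (tmap (coaction_infty \<beta>) id w) (w \<otimes>\<^sub>t unit (dual_hopf H))) =
      tmap id (comult (dual_hopf H)) w"
  proof (rule hat2_eqI)
    fix x y
    note infty_linear = clinear_coaction_infty[OF lin cont]
    have "hat (mult T2 (tmap (coaction_infty \<beta>) id w) (w \<otimes>\<^sub>t unit (dual_hopf H))) y =
        tlift (\<lambda>y y'. counit H y' *\<^sub>C mult T (coaction_infty \<beta> (W y)) w) (comult H y)"
      unfolding hat_T2 by (simp add: hat_unit hat_tmap[OF infty_linear] hat_w T_simps)
    also have "\<dots> = mult T (coaction_infty \<beta> (W y)) w"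
      by (rule tlift_counit(2))
        (auto intro!: linear_intros W_simps T_bilinear[THEN cbilinear_clinear(2)] clinear_compose[OF infty_linear])
    finally have "hat2 (assoc (mult T2 (tmap (coaction_infty \<beta>) id w) (w \<otimes>\<^sub>t unit (dual_hopf H)))) x y =
        conv (conv (\<lambda>x. W x * W y) (\<lambda>x. W (antipode H x))) W x"
      by (simp add: hat2_assoc hat_T hat_w action_infty)
    also have "\<dots> = conv (\<lambda>x. W x * W y) (conv (\<lambda>x. W (antipode H x)) W) x"
      by (rule conv_assoc) (auto intro!: linear_intros W_simps W_antipode)
    also have "conv (\<lambda>x. W (antipode H x)) W = (\<lambda>x. counit H x *\<^sub>C 1)"
      by (rule ext) (rule conv_antipode[OF W])
    also have "conv (\<lambda>x. W x * W y) \<dots> x = W x * W y"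
      by (simp add: conv_scalar linear_intros W_simps(1))
    finally show "hat2 (assoc (mult T2 (tmap (coaction_infty \<beta>) id w) (w \<otimes>\<^sub>t unit (dual_hopf H)))) x y =
        hat2 (tmap id (comult (dual_hopf H)) w) x y"
      by (simp only: hat2_comult hat_w W_simps)
  qed
  show ?thesis
    unfolding approximately_representable_def Let_def
    using unitary implements corepresentation covariance unfolding T2_def T_def by blast
qed

text \<open>
  The differences are linear in \<open>d\<close> and bounded uniformly in \<open>n\<close>, the coaction by continuity and
  the implementing expressions by the uniform bound on representations. Hence vanishing of the
  limit passes from a dense set to all of the algebra.
\<close>

lemma asymptotically_inner_dense:
  fixes \<beta> :: "'b::cstar_algebra \<Rightarrow> ('b, 'h dual) tensor" and U :: "nat \<Rightarrow> 'h \<Rightarrow> 'b"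
  assumes lin: "clinear \<beta>"
    and cont: "\<And>h. continuous_on UNIV (\<lambda>b. hat (\<beta> b) h)"
    and U: "\<And>n. star_rep (U n)"
    and dense: "closure X = UNIV"
    and X: "\<And>d. d \<in> X \<Longrightarrow> \<forall>\<^sub>F n in sequentially.
      hat (\<beta> d) h = conv (\<lambda>x. U n x * d) (\<lambda>x. U n (antipode H x)) h"
  shows "(\<lambda>n. hat (\<beta> d) h - conv (\<lambda>x. U n x * d) (\<lambda>x. U n (antipode H x)) h) \<longlonglongrightarrow> 0"
proof -
  define g where "g n d = conv (\<lambda>x. U n x * d) (\<lambda>x. U n (antipode H x)) h" for n d
  note U_simps = star_rep_simps[OF U] and bounded = star_rep_Bseq[of U, OF U]
  have U_antipode: "clinear (\<lambda>x. U n (antipode H x))" for n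
    by (rule clinear_compose[OF U_simps(1)]) (auto intro!: linear_intros)
  have lin_hat: "clinear (\<lambda>b. hat (\<beta> b) h)"
    by (rule clinear_compose[OF _ lin, of "\<lambda>t. hat t h"]) (auto intro!: linear_intros)
  obtain C where C: "C > 0" "\<And>d. norm (hat (\<beta> d) h) \<le> C * norm d"
    using clinear_continuous_bounded[OF lin_hat cont] by blast
  have "\<exists>K\<ge>0. \<forall>n d. norm (tlift (\<lambda>x y. U n x * d * U n (antipode H y)) t) \<le> K * norm d" for t
  proof (induction t rule: tensor_induct)
    case (elem a b)
    obtain K L where KL: "\<And>n. norm (U n a) \<le> K" "\<And>n. norm (U n (antipode H b)) \<le> L"
      using bounded by (meson Bseq_def)
    have pos: "K \<ge> 0" "L \<ge> 0"
      using KL[of 0] norm_ge_zero order_trans by blast+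
    have "norm (tlift (\<lambda>x y. U n x * d * U n (antipode H y)) (a \<otimes>\<^sub>t b)) \<le> K * L * norm d" for n d
    proof -
      have "tlift (\<lambda>x y. U n x * d * U n (antipode H y)) (a \<otimes>\<^sub>t b) = U n a * d * U n (antipode H b)"
        by (rule tlift_tensor) (auto intro!: linear_intros U_simps U_antipode)
      also have "norm \<dots> \<le> norm (U n a) * norm d * norm (U n (antipode H b))"
        by (meson norm_mult_ineq norm_ge_zero mult_right_mono order_trans)
      also have "\<dots> \<le> K * norm d * L"
        using KL[of n] pos by (intro mult_mono) auto
      finally show ?thesis by (simp add: mult_ac)
    qed
    then show ?case using pos by (intro exI[of _ "K * L"]) simp
  next
    case (add s t)
    then obtain K L where KL: "K \<ge> 0" "L \<ge> 0"
      "\<And>n d. norm (tlift (\<lambda>x y. U n x * d * U n (antipode H y)) s) \<le> K * norm d"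
      "\<And>n d. norm (tlift (\<lambda>x y. U n x * d * U n (antipode H y)) t) \<le> L * norm d"
      by blast
    have "clinear (tlift (\<lambda>x y. U n x * d * U n (antipode H y)))" for n d
      by (auto intro!: linear_intros U_simps U_antipode)
    note lin_t = clinear_simps[OF this]
    show ?case
      using KL by (intro exI[of _ "K + L"]) (auto simp: lin_t distrib_right intro: norm_triangle_mono)
  qed
  then obtain K where K: "K \<ge> 0" "\<And>n d. norm (g n d) \<le> K * norm d"
    unfolding g_def conv_def by blast
  have "clinear (g n)" for n
    unfolding g_def conv_def by (auto intro!: linear_intros)
  note g_simps = clinear_simps[OF this]
  have "(\<lambda>n. hat (\<beta> d) h - g n d) \<longlonglongrightarrow> 0"
  proof (rule LIMSEQ_I)
    fix \<epsilon> :: real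
    assume "\<epsilon> > 0"
    then have pos: "\<epsilon> / (C + K + 1) > 0" using C(1) K(1) by simp
    have "d \<in> closure X" by (simp add: dense)
    then obtain d' where d': "d' \<in> X" "norm (d - d') < \<epsilon> / (C + K + 1)"
      using pos unfolding closure_approachable by (metis dist_commute dist_norm)
    obtain M where M: "\<And>n. n \<ge> M \<Longrightarrow> hat (\<beta> d') h = g n d'"
      using X[OF d'(1)] unfolding g_def eventually_sequentially by blast
    have "norm (hat (\<beta> d) h - g n d) < \<epsilon>" if "n \<ge> M" for n
    proof -
      have "hat (\<beta> d) h - g n d = hat (\<beta> (d - d')) h - g n (d - d')"
        by (simp add: clinear_simps[OF lin_hat] g_simps M[OF that])
      also have "norm \<dots> \<le> C * norm (d - d') + K * norm (d - d')"
        by (rule norm_triangle_le_diff) (rule add_mono[OF C(2) K(2)])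
      also have "\<dots> = (C + K) * norm (d - d')" by (simp add: distrib_right)
      also have "\<dots> \<le> (C + K + 1) * norm (d - d')" by (intro mult_right_mono) auto
      also have "\<dots> < \<epsilon>" using d'(2) C(1) K(1) by (simp add: field_simps)
      finally show ?thesis .
    qed
    then show "\<exists>M. \<forall>n\<ge>M. norm (hat (\<beta> d) h - g n d - 0) < \<epsilon>"
      by auto
  qed
  then show ?thesis by (simp add: g_def)
qed

end

section \<open>Tensor powers\<close>

definition multilinear :: "('a::complex_vector list \<Rightarrow> 'c::complex_vector) \<Rightarrow> bool" where
  "multilinear f \<longleftrightarrow> (\<forall>xs ys. clinear (\<lambda>a. f (xs @ a # ys)))"

definition conj_multilinear :: "('a::complex_vector list \<Rightarrow> 'c::complex_vector) \<Rightarrow> bool" where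
  "conj_multilinear f \<longleftrightarrow> (\<forall>xs ys. conj_linear (\<lambda>a. f (xs @ a # ys)))"

lemma multilinear_elem: "multilinear elem"
proof -
  have "gen (xs @ (a + b) # ys) - gen (xs @ a # ys) - gen (xs @ b # ys) \<in> tpow_relations"
    "gen (xs @ (c *\<^sub>C a) # ys) - c *\<^sub>C gen (xs @ a # ys) \<in> tpow_relations"
    for xs ys and a b :: 'a and c
    unfolding tpow_relations_def by (rule complex_vector.span_base; blast)+
  then show ?thesis
    unfolding multilinear_def clinear_iff
    by (auto simp: elem.abs_eq plus_tpow.abs_eq scaleC_tpow.abs_eq tpow.abs_eq_iff algebra_simps)
qed

lemma plift_abs:
  assumes "multilinear f"
  shows "plift f (abs_tpow r) = lin_ext f r"
proof -
  have "lin_ext f (rep_tpow (abs_tpow r) - r) = 0"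
    using rep_abs_tpow[of r] unfolding tpow_relations_def
    by (rule lin_ext_span) (use assms in \<open>auto simp: lin_ext_diff lin_ext_scaleC clinear_iff multilinear_def\<close>)
  then show ?thesis by (simp add: plift_def lin_ext_diff)
qed

lemma plift_conj_abs:
  assumes "conj_multilinear f"
  shows "plift_conj f (abs_tpow r) = conj_ext f r"
proof -
  have "conj_ext f (rep_tpow (abs_tpow r) - r) = 0"
    using rep_abs_tpow[of r] unfolding tpow_relations_def
    by (rule conj_ext_span) (use assms in \<open>auto simp: conj_ext_diff conj_ext_scaleC conj_linear_def conj_multilinear_def\<close>)
  then show ?thesis by (simp add: plift_conj_def conj_ext_diff)
qed

lemma plift_conj_linear:
  assumes "conj_multilinear f"
  shows "conj_linear (plift_conj f)" "plift_conj f (elem zs) = f zs"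
proof -
  have "plift_conj f (s + t) = plift_conj f s + plift_conj f t"
    "plift_conj f (c *\<^sub>C s) = cnj c *\<^sub>C plift_conj f s" for s t c
  proof -
    obtain r r' where [simp]: "s = abs_tpow r" "t = abs_tpow r'"
      by (metis Quotient3_abs_rep[OF Quotient3_tpow])
    show "plift_conj f (s + t) = plift_conj f s + plift_conj f t"
      by (simp add: plus_tpow.abs_eq plift_conj_abs[OF assms] conj_ext_add)
    show "plift_conj f (c *\<^sub>C s) = cnj c *\<^sub>C plift_conj f s"
      by (simp add: scaleC_tpow.abs_eq plift_conj_abs[OF assms] conj_ext_scaleC)
  qed
  then show "conj_linear (plift_conj f)" by (simp add: conj_linear_def)
  show "plift_conj f (elem zs) = f zs"
    by (simp add: elem.abs_eq plift_conj_abs[OF assms])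
qed

lemma plift_multilinear_elem: "multilinear f \<Longrightarrow> plift f (elem zs) = f zs"
  by (simp add: elem.abs_eq plift_abs)

lemma clinear_plift:
  assumes "multilinear f"
  shows "clinear (plift f)"
  unfolding clinear_iff
proof safe
  fix s t :: "'a tpow" and c
  obtain r r' where [simp]: "s = abs_tpow r" "t = abs_tpow r'"
    by (metis Quotient3_abs_rep[OF Quotient3_tpow])
  show "plift f (s + t) = plift f s + plift f t"
    by (simp add: plus_tpow.abs_eq plift_abs[OF assms] lin_ext_add)
  show "plift f (c *\<^sub>C s) = c *\<^sub>C plift f s"
    by (simp add: scaleC_tpow.abs_eq plift_abs[OF assms] lin_ext_scaleC)
qed

lemma clinear_plift_param: "(\<And>xs. clinear (\<lambda>x. F x xs)) \<Longrightarrow> clinear (\<lambda>x. plift (F x) t)"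
  unfolding plift_def lin_ext_def by (auto intro!: linear_intros)

lemma subspace_tpow: "complex_vector.subspace (tpow n)"
  by (simp add: tpow_def)

lemma elem_in_tpow: "length xs = n \<Longrightarrow> elem xs \<in> tpow n"
  by (auto simp: tpow_def intro: complex_vector.span_base)

lemma tpow_induct [consumes 1, case_names zero elem add scale]:
  assumes "t \<in> tpow n" "P 0" "\<And>xs. length xs = n \<Longrightarrow> P (elem xs)"
    "\<And>s t. P s \<Longrightarrow> P t \<Longrightarrow> P (s + t)" "\<And>c s. P s \<Longrightarrow> P (c *\<^sub>C s)"
  shows "P t"
proof -
  have "t \<in> complex_vector.span (elem ` {xs. length xs = n})"
    using assms(1) by (simp add: tpow_def)
  then show ?thesis
  proof (induction rule: complex_vector.span_induct_alt)
    case (step c x y)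
    then obtain xs where "x = elem xs" "length xs = n" by blast
    then show ?case using assms(3-5) step.IH by simp
  qed (rule assms(2))
qed

lemma tlift_in_subspace:
  assumes "complex_vector.subspace S" "\<And>a b. f a b \<in> S" "\<And>a. clinear (f a)" "\<And>b. clinear (\<lambda>a. f a b)"
  shows "tlift f t \<in> S"
proof (induction t rule: tensor_induct)
  case (add s t)
  then show ?case
    by (simp add: clinear_simps[OF tlift_linear[OF assms(3,4)]] complex_vector.subspace_add[OF assms(1)])
qed (simp add: tlift_tensor assms)

text \<open>
  Splitting \<open>zs\<close> at the position of the varied entry shows how an entrywise product depends on that
  entry, which is needed for multilinearity in each of the two lists.
\<close>

lemma map2_split:
  assumes "length (xs @ a # ys) = length zs"
  obtains us c vs where "\<And>b. map2 m (xs @ b # ys) zs = map2 m xs us @ m b c # map2 m ys vs"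
proof
  let ?us = "take (length xs) zs" and ?c = "zs ! length xs" and ?vs = "drop (Suc (length xs)) zs"
  have zs: "zs = ?us @ ?c # ?vs" using assms by (simp add: id_take_nth_drop)
  show "map2 m (xs @ b # ys) zs = map2 m xs ?us @ m b ?c # map2 m ys ?vs" for b
  proof -
    have "map2 m (xs @ b # ys) (?us @ ?c # ?vs) = map2 m xs ?us @ m b ?c # map2 m ys ?vs"
      using assms by simp
    with zs show ?thesis by simp
  qed
qed

context
  fixes A :: "('a::complex_vector) star_alg"
  assumes A_mult: "cbilinear (mult A)" and A_star: "conj_linear (star A)"
begin

lemma tpow_alg_factor_multilinear:
  "multilinear (\<lambda>ys. if length xs = length ys then elem (map2 (mult A) xs ys) else 0)"
  "multilinear (\<lambda>xs. if length xs = length ys then elem (map2 (mult A) xs ys) else 0)"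
proof -
  have elem_lin: "clinear (\<lambda>a. elem (xs @ g a # ys))" if "clinear g" for xs ys and g :: "'a \<Rightarrow> 'a"
    using multilinear_elem that unfolding multilinear_def by (auto intro: clinear_compose[of "\<lambda>a. elem (xs @ a # ys)"])
  show "multilinear (\<lambda>xs. if length xs = length ys then elem (map2 (mult A) xs ys) else 0)"
    unfolding multilinear_def
  proof (intro allI)
    fix us vs
    show "clinear (\<lambda>a. if length (us @ a # vs) = length ys then elem (map2 (mult A) (us @ a # vs) ys) else 0)"
    proof (cases "length (us @ undefined # vs) = length ys")
      case True
      obtain us' c vs' where split: "\<And>b. map2 (mult A) (us @ b # vs) ys = map2 (mult A) us us' @ mult A b c # map2 (mult A) vs vs'"
        using map2_split[OF True] by metis
      show ?thesis
        using True unfolding split by (simp add: elem_lin cbilinear_clinear(2)[OF A_mult] clinear_basic)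
    qed (simp add: clinear_basic)
  qed
  show "multilinear (\<lambda>ys. if length xs = length ys then elem (map2 (mult A) xs ys) else 0)"
    unfolding multilinear_def
  proof (intro allI)
    fix us vs
    show "clinear (\<lambda>a. if length xs = length (us @ a # vs) then elem (map2 (mult A) xs (us @ a # vs)) else 0)"
    proof (cases "length (us @ undefined # vs) = length xs")
      case True
      have swap: "map2 (mult A) xs zs = map2 (\<lambda>b a. mult A a b) zs xs" for zs
        by (subst zip_commute) (simp add: case_prod_beta)
      obtain us' c vs' where split:
        "\<And>b. map2 (\<lambda>b a. mult A a b) (us @ b # vs) xs =
          map2 (\<lambda>b a. mult A a b) us us' @ mult A c b # map2 (\<lambda>b a. mult A a b) vs vs'"
        using map2_split[OF True, of "\<lambda>b a. mult A a b"] by metis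
      show ?thesis
        using True unfolding swap split by (simp add: elem_lin cbilinear_clinear(1)[OF A_mult] clinear_basic)
    qed (simp add: clinear_basic eq_commute[of "length xs"])
  qed
qed

lemma tpow_alg_mult_elem:
  assumes "length xs = length ys"
  shows "mult (tpow_alg A n) (elem xs) (elem ys) = elem (map2 (mult A) xs ys)"
proof -
  have "multilinear (\<lambda>xs. plift (\<lambda>ys. if length xs = length ys then elem (map2 (mult A) xs ys) else 0) t)" for t
    using tpow_alg_factor_multilinear(2) unfolding multilinear_def by (auto intro!: clinear_plift_param)
  note outer = plift_multilinear_elem[OF this]
  show ?thesis
    unfolding tpow_alg_def star_alg.simps outer plift_multilinear_elem[OF tpow_alg_factor_multilinear(1)]
    using assms by simp
qed

lemma bilinear_tpow_alg: "cbilinear (mult (tpow_alg A n))"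
proof -
  have "multilinear (\<lambda>xs. plift (\<lambda>ys. if length xs = length ys then elem (map2 (mult A) xs ys) else 0) t)" for t
    using tpow_alg_factor_multilinear(2) unfolding multilinear_def by (auto intro!: clinear_plift_param)
  then show ?thesis
    by (auto simp: cbilinear_def tpow_alg_def
        intro!: clinear_plift clinear_plift_param tpow_alg_factor_multilinear)
qed

lemma tpow_alg_star:
  shows "star (tpow_alg A n) (elem xs) = elem (map (star A) xs)" "conj_linear (star (tpow_alg A n))"
proof -
  have "conj_linear (\<lambda>a. elem (map (star A) (xs @ a # ys)))" for xs ys
  proof -
    have "clinear (\<lambda>a. elem (map (star A) xs @ a # map (star A) ys))"
      using multilinear_elem unfolding multilinear_def by blast
    from conj_linear_compose(2)[OF this A_star] show ?thesis by simp
  qed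
  then have "conj_multilinear (\<lambda>xs. elem (map (star A) xs))"
    by (simp add: conj_multilinear_def)
  then show "star (tpow_alg A n) (elem xs) = elem (map (star A) xs)" "conj_linear (star (tpow_alg A n))"
    by (simp_all add: tpow_alg_def plift_conj_linear)
qed

lemma tpow_alg_closed:
  "s \<in> tpow n \<Longrightarrow> t \<in> tpow n \<Longrightarrow> mult (tpow_alg A n) s t \<in> tpow n"
  "s \<in> tpow n \<Longrightarrow> star (tpow_alg A n) s \<in> tpow n"
  "unit (tpow_alg A n) \<in> tpow n"
proof -
  note closed = complex_vector.subspace_0[OF subspace_tpow] complex_vector.subspace_add[OF subspace_tpow]
    complex_vector.subspace_scale[OF subspace_tpow]
  note simps = clinear_simps[OF bilinear_tpow_alg[THEN cbilinear_clinear(1), OF clinear_basic(1)]]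
    clinear_simps[OF bilinear_tpow_alg[THEN cbilinear_clinear(2), OF clinear_basic(1)]]
  have elem_mult: "mult (tpow_alg A n) (elem xs) t \<in> tpow n" if "length xs = n" "t \<in> tpow n" for xs t
    using that(2)
    by (induction rule: tpow_induct)
      (simp_all add: simps closed that(1) tpow_alg_mult_elem elem_in_tpow)
  show "mult (tpow_alg A n) s t \<in> tpow n" if "s \<in> tpow n" "t \<in> tpow n"
    using that(1)
    by (induction rule: tpow_induct) (simp_all add: simps closed elem_mult that(2))
  have star_zero: "star (tpow_alg A n) 0 = 0"
    using tpow_alg_star(2) unfolding conj_linear_def
    by (metis complex_cnj_zero complex_vector.scale_zero_left)
  show "star (tpow_alg A n) s \<in> tpow n" if "s \<in> tpow n"
    using that tpow_alg_star(2)
    by (induction rule: tpow_induct) (simp_all add: star_zero closed tpow_alg_star(1) elem_in_tpow conj_linear_def)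
  show "unit (tpow_alg A n) \<in> tpow n"
    by (simp add: tpow_alg_def elem_in_tpow)
qed

lemma tpow_incl_closed:
  assumes "a \<in> tpow n"
  shows "tpow_incl A a \<in> tpow (Suc n)"
proof -
  have "clinear (\<lambda>a. elem (xs @ a # (ys @ [unit A])))" for xs ys
    using multilinear_elem unfolding multilinear_def by blast
  then have "multilinear (\<lambda>xs. elem (xs @ [unit A]))"
    by (simp add: multilinear_def)
  note lin = clinear_plift[OF this] and plift_elem = plift_multilinear_elem[OF this]
  show ?thesis
    using assms unfolding tpow_incl_def
    by (induction rule: tpow_induct)
      (simp_all add: clinear_simps[OF lin] plift_elem elem_in_tpow
        complex_vector.subspace_0[OF subspace_tpow] complex_vector.subspace_add[OF subspace_tpow]
        complex_vector.subspace_scale[OF subspace_tpow])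
qed

lemma place_closed: "i < n \<Longrightarrow> place A n i a \<in> tpow n"
  by (simp add: place_def elem_in_tpow)

lemma clinear_place:
  assumes "i < n"
  shows "clinear (place A n i)"
proof -
  have "clinear (\<lambda>a. elem (take i (replicate n (unit A)) @ a # drop (Suc i) (replicate n (unit A))))"
    using multilinear_elem unfolding multilinear_def by blast
  moreover have "place A n i = (\<lambda>a. elem (take i (replicate n (unit A)) @ a # drop (Suc i) (replicate n (unit A))))"
    using assms by (intro ext) (simp add: place_def upd_conv_take_nth_drop)
  ultimately show ?thesis by simp
qed

lemma place_mult:
  assumes "i < n" "mult A (unit A) (unit A) = unit A"
  shows "mult (tpow_alg A n) (place A n i a) (place A n i b) = place A n i (mult A a b)"
proof -
  have "map2 (mult A) ((replicate n (unit A))[i := a]) ((replicate n (unit A))[i := b]) =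
      (replicate n (unit A))[i := mult A a b]"
    using assms by (intro nth_equalityI) (auto simp: nth_list_update)
  then show ?thesis
    by (simp add: place_def tpow_alg_mult_elem)
qed

text \<open>
  In each tensor factor at least one of the two entries is the unit, so it is enough that the unit
  is neutral for the placed elements.
\<close>

lemma place_commute:
  assumes "i < n" "j < n" "i \<noteq> j" "mult A (unit A) (unit A) = unit A"
    "mult A a (unit A) = a" "mult A (unit A) a = a" "mult A b (unit A) = b" "mult A (unit A) b = b"
  shows "mult (tpow_alg A n) (place A n i a) (place A n j b) =
    mult (tpow_alg A n) (place A n j b) (place A n i a)"
proof -
  have "map2 (mult A) ((replicate n (unit A))[i := a]) ((replicate n (unit A))[j := b]) =
      map2 (mult A) ((replicate n (unit A))[j := b]) ((replicate n (unit A))[i := a])"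
    using assms by (intro nth_equalityI) (auto simp: nth_list_update)
  then show ?thesis
    by (simp add: place_def tpow_alg_mult_elem)
qed

lemma place_star:
  assumes "star A (unit A) = unit A"
  shows "star (tpow_alg A n) (place A n i a) = place A n i (star A a)"
  by (simp add: place_def tpow_alg_star map_update assms)

end

section \<open>The crossed product\<close>

text \<open>
  The unitary $V$ lies in $(1^0 \rtimes H) \otimes H^0$, so the computation of $u_n$ takes place in
  the tensor powers of $1^0 \rtimes H$. The action of $H$ on the unit of $H^0$ is given by the
  counit, and therefore $h \mapsto 1^0 \rtimes h$ is a *-homomorphism.
\<close>

context hopf_coordinates
begin

lemma dual_unit_laws:
  "mult (dual_hopf H) (unit (dual_hopf H)) (unit (dual_hopf H)) = unit (dual_hopf H)"
  "star (dual_hopf H) (unit (dual_hopf H)) = unit (dual_hopf H)"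
  "hat (comult (dual_hopf H) (unit (dual_hopf H))) l = counit H l *\<^sub>C unit (dual_hopf H)"
  using tlift_counit(1)[OF clinear_Hopf(2)]
  by (auto intro!: dual_eqI simp: app_dual_mult app_dual_unit app_dual_star app_hat_dual_comult
      counit_hom counit_antipode scaleC_dual.rep_eq mult.commute)

lemma algA_mult:
  "mult (algA H) (unit (dual_hopf H) \<otimes>\<^sub>t h) (unit (dual_hopf H) \<otimes>\<^sub>t k) = unit (dual_hopf H) \<otimes>\<^sub>t mult H h k"
  and bilinear_algA: "cbilinear (mult (algA H))"
proof -
  let ?K = "dual_hopf H"
  note intros = linear_intros clinear_dual_comult clinear_compose[OF clinear_dual_comult]
    cbilinear_dual[THEN cbilinear_clinear(1)] cbilinear_dual[THEN cbilinear_clinear(2)]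
  have mult: "mult (algA H) = (\<lambda>s t. tlift (\<lambda>a l. tlift (\<lambda>b m. tlift (\<lambda>l1 l2.
      mult ?K a (hat (comult ?K b) l1) \<otimes>\<^sub>t mult H l2 m) (comult H l)) t) s)"
    by (simp add: algA_def crossed_product_def hat_def)
  show "cbilinear (mult (algA H))"
    unfolding mult cbilinear_def by (auto intro!: intros)
  have "mult (algA H) (unit ?K \<otimes>\<^sub>t h) (unit ?K \<otimes>\<^sub>t k) =
      tlift (\<lambda>l1 l2. mult ?K (unit ?K) (hat (comult ?K (unit ?K)) l1) \<otimes>\<^sub>t mult H l2 k) (comult H h)"
    unfolding mult by (simp add: tlift_tensor intros)
  also have "\<dots> = tlift (\<lambda>l1 l2. counit H l1 *\<^sub>C (unit ?K \<otimes>\<^sub>t mult H l2 k)) (comult H h)"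
    by (simp add: dual_unit_laws clinear_simps[OF cbilinear_dual[THEN cbilinear_clinear(1), OF clinear_basic(1)]] tensor_simps)
  also have "\<dots> = unit ?K \<otimes>\<^sub>t mult H h k"
    by (rule tlift_counit) (auto intro!: intros)
  finally show "mult (algA H) (unit ?K \<otimes>\<^sub>t h) (unit ?K \<otimes>\<^sub>t k) = unit ?K \<otimes>\<^sub>t mult H h k" .
qed

lemma algA_star:
  "star (algA H) (unit (dual_hopf H) \<otimes>\<^sub>t h) = unit (dual_hopf H) \<otimes>\<^sub>t star H h"
  and conj_linear_algA: "conj_linear (star (algA H))"
proof -
  let ?K = "dual_hopf H"
  define f where "f a l1 l2 = hat (comult ?K (star ?K a)) (star H l1) \<otimes>\<^sub>t star H l2" for a l1 l2
  have f: "conj_linear (f a l1)" "conj_linear (\<lambda>l1. f a l1 l2)" "conj_linear (\<lambda>a. f a l1 l2)" for a l1 l2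
    using conj_linear_star_H conj_linear_star_dual
    by (simp_all add: conj_linear_def f_def tensor_simps clinear_simps[OF clinear_dual_comult]
       clinear_simps[OF clinear_hat(1)[OF clinear_basic(1)]] clinear_simps[OF clinear_hat(2)[OF clinear_basic(1)]])
  have star: "star (algA H) = tlift_conj (\<lambda>a l. tlift_conj (f a) (comult H l))"
    by (simp add: algA_def crossed_product_def hat_def f_def[abs_def])
  have inner: "conj_linear (\<lambda>l. tlift_conj (f a) (comult H l))" "conj_linear (\<lambda>a. tlift_conj (f a) (comult H l))" for a l
    by (rule conj_linear_compose(1)[OF conj_linear_tlift_conj(1)[OF f(1,2)] clinear_Hopf(1)])
      (rule conj_linear_tlift_conj_param[OF f(3)])
  show "conj_linear (star (algA H))"
    unfolding star by (rule conj_linear_tlift_conj(1)[OF inner])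
  have "tlift_conj (f (unit ?K)) t = unit ?K \<otimes>\<^sub>t star H (tlift (\<lambda>x y. counit H x *\<^sub>C y) t)" for t
  proof (induction t rule: tensor_induct)
    case (elem a b)
    show ?case
      using conj_linear_star_H
      by (simp add: conj_linear_tlift_conj(2)[OF f(1,2)] tlift_tensor linear_intros)
        (simp add: f_def dual_unit_laws counit_hom tensor_simps conj_linear_def)
  next
    case (add s t)
    have lin: "clinear (tlift (\<lambda>x y. counit H x *\<^sub>C y))" by (auto intro!: linear_intros)
    show ?case
      using add conj_linear_star_H conj_linear_tlift_conj(1)[OF f(1,2)]
      by (simp add: conj_linear_def clinear_simps[OF lin] tensor_simps)
  qed
  then show "star (algA H) (unit ?K \<otimes>\<^sub>t h) = unit ?K \<otimes>\<^sub>t star H h"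
    unfolding star by (simp add: conj_linear_tlift_conj(2)[OF inner] counit_laws)
qed

lemma unit_algA: "unit (algA H) = unit (dual_hopf H) \<otimes>\<^sub>t unit H"
  by (simp add: algA_def crossed_product_def)

lemma hat_unitaryV: "hat (unitaryV H) h = unit (dual_hopf H) \<otimes>\<^sub>t h"
proof -
  let ?P = "\<lambda>V. \<forall>h :: 'h. hat V h = unit (dual_hopf H) \<otimes>\<^sub>t h"
  have "?P (\<Sum>b\<in>B. (unit (dual_hopf H) \<otimes>\<^sub>t b) \<otimes>\<^sub>t e b)"
    by (intro allI hat_of_map) (auto intro!: linear_intros)
  moreover have "V = V'" if "?P V" "?P V'" for V V'
    using that by (intro hat_eqI) simp
  ultimately have "\<exists>!V. ?P V" by blast
  then have "?P (THE V. ?P V)" by (rule theI')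
  then show ?thesis by (simp add: unitaryV_def hat_def)
qed

lemma star_unit_H: "star H (unit H) = unit H"
  by (metis star_H_simps(1-3))

section \<open>The representations on the tensor powers\<close>

context
  fixes \<kappa> :: "('h dual, 'h) tensor tpow \<Rightarrow> 'b::cstar_algebra" and n :: nat
  assumes \<kappa>: "unital_star_hom_on (tpow n) (algAn H n) class_alg \<kappa>"
begin

lemma \<kappa>_simps:
  "clinear \<kappa>" "\<kappa> (unit (algAn H n)) = 1"
  "x \<in> tpow n \<Longrightarrow> y \<in> tpow n \<Longrightarrow> \<kappa> (mult (algAn H n) x y) = \<kappa> x * \<kappa> y"
  "x \<in> tpow n \<Longrightarrow> \<kappa> (star (algAn H n) x) = adj (\<kappa> x)"
  using \<kappa> by (simp_all add: unital_star_hom_on_def class_alg_def)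

lemma bilinear_algAn: "cbilinear (mult (algAn H n))"
  by (rule bilinear_tpow_alg[OF bilinear_algA conj_linear_algA])

lemma hat_mult_algAn:
  assumes "\<And>h. hat s h \<in> tpow n" "\<And>h. hat t h \<in> tpow n"
  shows "hat (mult (algAnH0 H n) s t) h \<in> tpow n"
    and "\<kappa> (hat (mult (algAnH0 H n) s t) h) = conv (\<lambda>x. \<kappa> (hat s x)) (\<lambda>x. \<kappa> (hat t x)) h"
proof -
  note intros = linear_intros bilinear_algAn[THEN cbilinear_clinear(1)] bilinear_algAn[THEN cbilinear_clinear(2)]
  show "hat (mult (algAnH0 H n) s t) h \<in> tpow n"
    unfolding hat_mult[OF bilinear_algAn]
    by (rule tlift_in_subspace[OF subspace_tpow])
      (auto intro!: intros tpow_alg_closed bilinear_algA conj_linear_algA assms)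
  have "\<kappa> (hat (mult (algAnH0 H n) s t) h) = tlift (\<lambda>x y. \<kappa> (mult (algAn H n) (hat s x) (hat t y))) (comult H h)"
    unfolding hat_mult[OF bilinear_algAn]
    by (rule clinear_apply_tlift[OF \<kappa>_simps(1)]) (auto intro!: intros)
  then show "\<kappa> (hat (mult (algAnH0 H n) s t) h) = conv (\<lambda>x. \<kappa> (hat s x)) (\<lambda>x. \<kappa> (hat t x)) h"
    by (simp add: \<kappa>_simps assms conv_def)
qed

lemma star_rep_place:
  assumes "i < n"
  shows "star_rep (\<lambda>h. \<kappa> (place (algA H) n i (unit (dual_hopf H) \<otimes>\<^sub>t h)))"
proof (rule star_repI)
  note A = bilinear_algA conj_linear_algA
  have unit: "mult (algA H) (unit (algA H)) (unit (algA H)) = unit (algA H)" "star (algA H) (unit (algA H)) = unit (algA H)"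
    by (simp_all add: unit_algA algA_mult algA_star star_H_simps star_unit_H)
  note closed = place_closed[OF A assms]
  show "clinear (\<lambda>h. \<kappa> (place (algA H) n i (unit (dual_hopf H) \<otimes>\<^sub>t h)))"
    by (rule clinear_compose[OF \<kappa>_simps(1) clinear_compose[OF clinear_place[OF A assms]]])
      (auto intro!: linear_intros)
  show "\<kappa> (place (algA H) n i (unit (dual_hopf H) \<otimes>\<^sub>t unit H)) = 1"
    using \<kappa>_simps(2) list_update_id[of "replicate n (unit (algA H))" i] assms
    by (simp add: place_def tpow_alg_def flip: unit_algA)
  show "\<kappa> (place (algA H) n i (unit (dual_hopf H) \<otimes>\<^sub>t mult H x y)) =
    \<kappa> (place (algA H) n i (unit (dual_hopf H) \<otimes>\<^sub>t x)) * \<kappa> (place (algA H) n i (unit (dual_hopf H) \<otimes>\<^sub>t y))" for x y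
    by (simp add: place_mult[OF A assms unit(1)] algA_mult flip: \<kappa>_simps(3)[OF closed closed])
  show "\<kappa> (place (algA H) n i (unit (dual_hopf H) \<otimes>\<^sub>t star H x)) =
    adj (\<kappa> (place (algA H) n i (unit (dual_hopf H) \<otimes>\<^sub>t x)))" for x
    by (simp add: place_star[OF A unit(2)] algA_star flip: \<kappa>_simps(4)[OF closed])
qed

lemma place_commuting:
  assumes "i < n" "j < n" "i \<noteq> j"
  shows "\<kappa> (place (algA H) n i (unit (dual_hopf H) \<otimes>\<^sub>t x)) * \<kappa> (place (algA H) n j (unit (dual_hopf H) \<otimes>\<^sub>t y)) =
    \<kappa> (place (algA H) n j (unit (dual_hopf H) \<otimes>\<^sub>t y)) * \<kappa> (place (algA H) n i (unit (dual_hopf H) \<otimes>\<^sub>t x))"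
proof -
  note A = bilinear_algA conj_linear_algA
  show ?thesis
    by (simp add: assms place_closed[OF A] flip: \<kappa>_simps(3))
      (subst place_commute[OF A assms], auto simp: unit_algA algA_mult star_H_simps)
qed

text \<open>
  Each factor \<open>v_at H n i\<close> contributes the representation of \<open>H\<close> in the \<open>i\<close>-th tensor factor, and
  multiplying by it convolves with that representation. The induction carries along that the
  partial product commutes with the representations in the factors not yet used, which is what
  \<open>star_rep_conv\<close> requires in the next step.
\<close>

lemma partial_product_rep:
  assumes "set is \<subseteq> {..<n}" "distinct is"
  defines "R \<equiv> foldr (\<lambda>i x. mult (algAnH0 H n) (v_at H n i) x) is (unit (algAnH0 H n))"
  shows "(\<forall>h. hat R h \<in> tpow n) \<and> star_rep (\<lambda>h. \<kappa> (hat R h)) \<and>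
    (\<forall>j x y. j < n \<longrightarrow> j \<notin> set is \<longrightarrow>
      \<kappa> (place (algA H) n j (unit (dual_hopf H) \<otimes>\<^sub>t x)) * \<kappa> (hat R y) =
      \<kappa> (hat R y) * \<kappa> (place (algA H) n j (unit (dual_hopf H) \<otimes>\<^sub>t x)))"
  using assms(1,2) unfolding R_def
proof (induction "is")
  case Nil
  have unit: "hat (unit (algAnH0 H n)) h = counit H h *\<^sub>C unit (algAn H n)" for h
    by (simp add: tensor_alg_def hat_tensor_unit)
  show ?case
    using star_rep_counit tpow_alg_closed(3)[OF bilinear_algA conj_linear_algA]
    by (simp add: unit clinear_simps[OF \<kappa>_simps(1)] \<kappa>_simps mult_scaleC_left mult_scaleC_right
        complex_vector.subspace_scale[OF subspace_tpow])
next
  case (Cons i "is")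
  note A = bilinear_algA conj_linear_algA
  let ?R = "foldr (\<lambda>i x. mult (algAnH0 H n) (v_at H n i) x) is (unit (algAnH0 H n))"
  let ?p = "\<lambda>i h. \<kappa> (place (algA H) n i (unit (dual_hopf H) \<otimes>\<^sub>t h))"
  let ?q = "\<lambda>h. \<kappa> (hat ?R h)"
  have i: "i < n" "i \<notin> set is" using Cons.prems by auto
  have IH: "hat ?R h \<in> tpow n" "star_rep ?q"
    "j < n \<Longrightarrow> j \<notin> set is \<Longrightarrow> ?p j x * ?q y = ?q y * ?p j x" for h j x y
    using Cons by auto
  have v: "hat (v_at H n i) h = place (algA H) n i (unit (dual_hopf H) \<otimes>\<^sub>t h)" for h
    by (simp add: v_at_def hat_tmap clinear_place[OF A i(1)] hat_unitaryV)
  have closed: "hat (mult (algAnH0 H n) (v_at H n i) ?R) h \<in> tpow n" for h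
    by (rule hat_mult_algAn) (simp_all add: v IH place_closed[OF A i(1)])
  have conv: "(\<lambda>h. \<kappa> (hat (mult (algAnH0 H n) (v_at H n i) ?R) h)) = conv (?p i) ?q"
    using hat_mult_algAn(2)[of "v_at H n i" ?R] by (auto simp: v IH place_closed[OF A i(1)])
  note p = star_rep_place[THEN star_rep_simps(1)] and q = star_rep_simps(1)[OF IH(2)]
  have comm: "?p j x * conv (?p i) ?q y = conv (?p i) ?q y * ?p j x"
    if j: "j < n" "j \<notin> set (i # is)" for j x y
  proof -
    have pointwise: "?p j x * (?p i a * ?q b) = (?p i a * ?q b) * ?p j x" for a b
    proof -
      have "?p j x * (?p i a * ?q b) = (?p j x * ?p i a) * ?q b" by (rule mult.assoc[symmetric])
      also have "?p j x * ?p i a = ?p i a * ?p j x"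
        using j by (intro place_commuting[OF _ i(1)]) auto
      also have "\<dots> * ?q b = ?p i a * (?p j x * ?q b)" by (rule mult.assoc)
      also have "?p j x * ?q b = ?q b * ?p j x" using j by (intro IH(3)) auto
      finally show ?thesis by (simp only: mult.assoc)
    qed
    have "?p j x * conv (?p i) ?q y = tlift (\<lambda>a b. ?p j x * (?p i a * ?q b)) (comult H y)"
      unfolding conv_def by (rule clinear_apply_tlift) (auto intro!: linear_intros p q i)
    also have "\<dots> = tlift (\<lambda>a b. (?p i a * ?q b) * ?p j x) (comult H y)"
      by (simp only: pointwise)
    also have "\<dots> = conv (?p i) ?q y * ?p j x"
      unfolding conv_def by (rule clinear_apply_tlift[symmetric]) (auto intro!: linear_intros p q i)
    finally show ?thesis .
  qed
  have "star_rep (conv (?p i) ?q)"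
    by (rule star_rep_conv[OF star_rep_place[OF i(1)] IH(2)]) (rule IH(3)[OF i])
  then show ?case
    using closed comm fun_cong[OF conv] by (simp add: conv)
qed

lemma u_n_rep:
  "hat (u_n H n) h \<in> tpow n" "star_rep (\<lambda>h. \<kappa> (hat (u_n H n) h))"
  using partial_product_rep[of "[0..<n]"] by (auto simp: u_n_def atLeast0LessThan)

text \<open>
  Conjugation by a unitary tensor in terms of linear maps: the middle factor $a \otimes 1^0$ belongs
  to $h \mapsto \epsilon(h) a$ and is absorbed by the counit law, and the adjoint contributes the
  antipode.
\<close>

lemma hat_rho_n:
  assumes a: "a \<in> tpow n"
  shows "\<kappa> (hat (rho_n H n a) h) =
    conv (\<lambda>x. \<kappa> (hat (u_n H n) x) * \<kappa> a) (\<lambda>x. \<kappa> (hat (u_n H n) (antipode H x))) h"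
proof -
  note A = bilinear_algA conj_linear_algA
  note rep = star_rep_simps[OF u_n_rep(2)]
  have unit: "hat (a \<otimes>\<^sub>t unit (dual_hopf H)) x = counit H x *\<^sub>C a" for x
    by (rule hat_tensor_unit)
  have unit_closed: "hat (a \<otimes>\<^sub>t unit (dual_hopf H)) x \<in> tpow n" for x
    unfolding unit by (rule complex_vector.subspace_scale[OF subspace_tpow a])
  have star: "hat (star (algAnH0 H n) (u_n H n)) x = star (algAn H n) (hat (u_n H n) (star H (antipode H x)))" for x
    by (rule hat_star[OF tpow_alg_star(2)[OF A]])
  have star_closed: "hat (star (algAnH0 H n) (u_n H n)) x \<in> tpow n" for x
    unfolding star by (rule tpow_alg_closed(2)[OF A u_n_rep(1)])
  have \<kappa>_star: "\<kappa> (hat (star (algAnH0 H n) (u_n H n)) x) = \<kappa> (hat (u_n H n) (antipode H x))" for x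
    unfolding star by (simp add: \<kappa>_simps u_n_rep(1) rep adj_adj)
  have \<kappa>_left: "\<kappa> (hat (mult (algAnH0 H n) (u_n H n) (a \<otimes>\<^sub>t unit (dual_hopf H))) x) = \<kappa> (hat (u_n H n) x) * \<kappa> a" for x
    unfolding hat_mult_algAn(2)[OF u_n_rep(1) unit_closed] unit
    by (simp add: clinear_simps[OF \<kappa>_simps(1)] conv_counit(2)[OF rep(1)])
  show ?thesis
    unfolding rho_n_def Let_def
      hat_mult_algAn(2)[OF hat_mult_algAn(1)[OF u_n_rep(1) unit_closed] star_closed] \<kappa>_left \<kappa>_star ..
qed

end

end

section \<open>The inductive limit\<close>

theorem proposition7p4:
  fixes H :: "('h::complex_vector) hopf"
    and \<kappa> :: "nat \<Rightarrow> ('h dual, 'h) tensor tpow \<Rightarrow> 'b::cstar_algebra"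
    and \<rho> :: "'b \<Rightarrow> ('b, 'h dual) tensor"
  assumes "cstar_hopf_algebra H"
    and "uhf_limit H \<kappa>"
    and "limit_coaction H \<kappa> \<rho>"
  shows "approximately_representable (dual_hopf H) \<rho>"
proof -
  obtain B e where "hopf_coordinates H B e"
    using coordinates_exist[OF assms(1)] by blast
  then interpret hopf_coordinates H B e .
  have \<kappa>: "unital_star_hom_on (tpow n) (algAn H n) class_alg (\<kappa> n)" if "n \<ge> 1" for n
    using assms(2) that by (simp add: uhf_limit_def inductive_limit_def)
  have incl: "\<kappa> (Suc n) (tpow_incl (algA H) a) = \<kappa> n a" if "n \<ge> 1" "a \<in> tpow n" for n a
    using assms(2) that by (simp add: uhf_limit_def inductive_limit_def)
  define X where "X = (\<Union>n\<in>{1..}. \<kappa> n ` tpow n)"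
  have dense: "closure X = UNIV"
    using assms(2) by (simp add: X_def uhf_limit_def inductive_limit_def)
  have lin: "clinear \<rho>"
    using assms(3) by (simp add: limit_coaction_def coaction_def unital_star_hom_on_def)
  have cont: "continuous_on UNIV (\<lambda>b. hat (\<rho> b) h)" for h
    using assms(3) by (simp add: limit_coaction_def hat_def)
  \<comment> \<open>the tensor powers start at level one, whereas sequences start at zero\<close>
  define U where "U n h = \<kappa> (Suc n) (hat (u_n H (Suc n)) h)" for n h
  have U: "star_rep (U n)" for n
    unfolding U_def by (rule u_n_rep(2)[OF \<kappa>]) simp
  have level: "hat (\<rho> (\<kappa> (Suc n) a)) h = conv (\<lambda>x. U n x * \<kappa> (Suc n) a) (\<lambda>x. U n (antipode H x)) h"
    if "a \<in> tpow (Suc n)" for n a h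
  proof -
    have "\<rho> (\<kappa> (Suc n) a) = tmap (\<kappa> (Suc n)) id (rho_n H (Suc n) a)"
      using assms(3) that by (simp add: limit_coaction_def)
    then show ?thesis
      using hat_rho_n[OF \<kappa> that, of h] \<kappa>[of "Suc n"]
      by (simp add: hat_tmap unital_star_hom_on_def U_def[abs_def])
  qed
  \<comment> \<open>an element of one level belongs to all later ones, where \<open>level\<close> applies to it\<close>
  have in_later: "\<exists>a'\<in>tpow n. \<kappa> n a' = \<kappa> m a" if "m \<ge> 1" "a \<in> tpow m" "n \<ge> m" for m n a
    using that(3)
  proof (induction n rule: dec_induct)
    case base
    then show ?case using that by blast
  next
    case (step n)
    then obtain a' where "a' \<in> tpow n" "\<kappa> n a' = \<kappa> m a" by blast
    then show ?case
      using incl[of n a'] tpow_incl_closed[OF bilinear_algA conj_linear_algA, of a' n] step that(1) by force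
  qed
  show ?thesis
  proof (rule approximately_representable_criterion[of \<rho> U, OF lin cont U])
    show "hat (\<rho> (U n y)) h = conv (\<lambda>x. U n x * U n y) (\<lambda>x. U n (antipode H x)) h" for n y h
      unfolding U_def[of n y] by (rule level) (rule u_n_rep(1)[OF \<kappa>], simp)
    show "(\<lambda>n. hat (\<rho> d) h - conv (\<lambda>x. U n x * d) (\<lambda>x. U n (antipode H x)) h) \<longlonglongrightarrow> 0" for d h
    proof (rule asymptotically_inner_dense[OF lin cont U dense])
      fix d
      assume "d \<in> X"
      then obtain m a where m: "m \<ge> 1" "a \<in> tpow m" "d = \<kappa> m a" by (auto simp: X_def)
      have "hat (\<rho> d) h = conv (\<lambda>x. U n x * d) (\<lambda>x. U n (antipode H x)) h" if "n \<ge> m" for n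
        using in_later[of m a "Suc n"] m that level by force
      then show "\<forall>\<^sub>F n in sequentially. hat (\<rho> d) h = conv (\<lambda>x. U n x * d) (\<lambda>x. U n (antipode H x)) h"
        unfolding eventually_sequentially by blast
    qed
  qed
qed

end
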